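(* The following are equivalent: (1) The sets $\mathrm{Fix}_k(\sigma)^\circ$ are closed in $X$ for all $k\in\mathbb{Z}$. (2) There exists a (not necessarily continuous) projection $E'$ from $\ell^1(\Sigma)$ onto $C(X)'_1$ which is positive in the sense that $\phi(E'(\ell))\ge0$ for all $\ell\in\ell^1(\Sigma)_+$ and all states $\phi$ of $C(X)'_1$. In that case a projection as in (2) is unique. Denoting it by $E'$ and denoting by $\chi_k$ the (continuous) characteristic function of $\mathrm{Fix}_k(\sigma)^\circ$, it is given by $E'\big(\sum_kf_k\delta^k\big)=\sum_k\chi_kf_k\delta^k$ for $\sum_kf_k\delta^k\in\ell^1(\Sigma)$. Furthermore, $E'$ is a faithful involutive norm one projection, is a morphism of $C(X)'_1$-bimodules, and restricts to a projection from $c_{00}(\Sigma)$ onto $C(X)'_{00}$.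
   Context: Let $X$ be a non-empty compact Hausdorff space and $\sigma:X\to X$ a homeomorphism; $\mathrm{Fix}_k(\sigma)=\{x:\sigma^kx=x\}$ and superscript $\circ$ denotes interior. $C(X)$ is the algebra of continuous complex functions with sup norm, $\alpha(f)=f\circ\sigma^{-1}$. $\ell^1(\Sigma)$ is the set of $\ell:\mathbb{Z}\to C(X)$ with $\|\ell\|=\sum_k\|\ell(k)\|_\infty<\infty$, product $(\ell\ell')(n)=\sum_k\ell(k)\alpha^k(\ell'(n-k))$, involution $\ell^*(n)=\overline{\alpha^n(\ell(-n))}$; it is a unital Banach $*$-algebra. With $\delta$ the element equal to the constant $1$ at $1\in\mathbb{Z}$ and $0$ elsewhere, elements are written $\sum_kf_k\delta^k$ ($f_k=\ell(k)$), and $C(X)$ is embedded as $\{f\delta^0\}$. $c_{00}(\Sigma)$ is the $*$-subalgebra of finite sums. $C(X)'_1$ and $C(X)'_{00}$ are the commutants of $C(X)$ in $\ell^1(\Sigma)$ and in $c_{00}(\Sigma)$. The positive cone $\ell^1(\Sigma)_+$ is the set of all finite sums $\sum_j\ell_j^*\ell_j$, $\ell_j\in\ell^1(\Sigma)$; a linear map on $\ell^1(\Sigma)$ is faithful if $0$ is the only element of $\ell^1(\Sigma)_+$ in its kernel. A state of $C(X)'_1$ is a linear functional $\phi$ with $\phi(a^*a)\ge0$ and $\phi(1)=1$. A projection onto $C(X)'_1$ is a linear idempotent map with range $C(X)'_1$; involutive means $E'(\ell^* )=E'(\ell)^*$. *)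

theory Defs
  imports "HOL-Analysis.Analysis"
begin

text \<open>Elements of l1(Sigma) are represented as maps  int => ('a => complex).
  Elements of C(X) are continuous maps 'a => complex (X = UNIV of a compact Hausdorff type).\<close>

type_synonym 'a elt = "int \<Rightarrow> 'a \<Rightarrow> complex"

definition sigpow :: "('a \<Rightarrow> 'a) \<Rightarrow> int \<Rightarrow> 'a \<Rightarrow> 'a" where
  "sigpow \<sigma> k = (if 0 \<le> k then \<sigma> ^^ nat k else inv \<sigma> ^^ nat (- k))"

definition Fix :: "('a \<Rightarrow> 'a) \<Rightarrow> int \<Rightarrow> 'a set" where
  "Fix \<sigma> k = {x. sigpow \<sigma> k x = x}"

definition contfun :: "('a::topological_space \<Rightarrow> complex) \<Rightarrow> bool" where
  "contfun f \<longleftrightarrow> continuous_on UNIV f"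

definition supnorm :: "('a \<Rightarrow> complex) \<Rightarrow> real" where
  "supnorm f = (SUP x. cmod (f x))"

definition l1space :: "'a::topological_space elt set" where
  "l1space = {a. (\<forall>k. contfun (a k)) \<and> (\<lambda>k. supnorm (a k)) summable_on UNIV}"

definition l1norm :: "'a elt \<Rightarrow> real" where
  "l1norm a = (\<Sum>\<^sub>\<infinity>k. supnorm (a k))"

text \<open>(a a')(n) = sum_k a(k) alpha^k(a'(n-k)),  alpha^k(f) = f o sigma^(-k)\<close>
definition lmult :: "('a \<Rightarrow> 'a) \<Rightarrow> 'a elt \<Rightarrow> 'a elt \<Rightarrow> 'a elt" where
  "lmult \<sigma> a b = (\<lambda>n x. \<Sum>\<^sub>\<infinity>k. a k x * b (n - k) (sigpow \<sigma> (- k) x))"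

text \<open>a*(n) = conj(alpha^n(a(-n)))\<close>
definition lstar :: "('a \<Rightarrow> 'a) \<Rightarrow> 'a elt \<Rightarrow> 'a elt" where
  "lstar \<sigma> a = (\<lambda>n x. cnj (a (- n) (sigpow \<sigma> (- n) x)))"

definition ladd :: "'a elt \<Rightarrow> 'a elt \<Rightarrow> 'a elt" where
  "ladd a b = (\<lambda>n x. a n x + b n x)"

definition lscale :: "complex \<Rightarrow> 'a elt \<Rightarrow> 'a elt" where
  "lscale c a = (\<lambda>n x. c * a n x)"

definition lzero :: "'a elt" where
  "lzero = (\<lambda>n x. 0)"

definition emb :: "('a \<Rightarrow> complex) \<Rightarrow> 'a elt" where
  "emb f = (\<lambda>n. if n = 0 then f else (\<lambda>x. 0))"

definition lone :: "'a elt" where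
  "lone = emb (\<lambda>x. 1)"

definition c00space :: "'a::topological_space elt set" where
  "c00space = {a \<in> l1space. finite {k. a k \<noteq> (\<lambda>x. 0)}}"

definition comm1 :: "('a::topological_space \<Rightarrow> 'a) \<Rightarrow> 'a elt set" where
  "comm1 \<sigma> = {a \<in> l1space. \<forall>f. contfun f \<longrightarrow> lmult \<sigma> (emb f) a = lmult \<sigma> a (emb f)}"

definition comm00 :: "('a::topological_space \<Rightarrow> 'a) \<Rightarrow> 'a elt set" where
  "comm00 \<sigma> = {a \<in> c00space. \<forall>f. contfun f \<longrightarrow> lmult \<sigma> (emb f) a = lmult \<sigma> a (emb f)}"

definition poscone :: "('a::topological_space \<Rightarrow> 'a) \<Rightarrow> 'a elt set" where
  "poscone \<sigma> = {a. \<exists>(m::nat) ls. (\<forall>j<m. ls j \<in> l1space) \<and>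
      a = (\<lambda>n x. \<Sum>j<m. lmult \<sigma> (lstar \<sigma> (ls j)) (ls j) n x)}"

definition nonneg :: "complex \<Rightarrow> bool" where
  "nonneg z \<longleftrightarrow> Im z = 0 \<and> 0 \<le> Re z"

definition is_state :: "('a::topological_space \<Rightarrow> 'a) \<Rightarrow> ('a elt \<Rightarrow> complex) \<Rightarrow> bool" where
  "is_state \<sigma> \<phi> \<longleftrightarrow>
     (\<forall>a\<in>comm1 \<sigma>. \<forall>b\<in>comm1 \<sigma>. \<phi> (ladd a b) = \<phi> a + \<phi> b) \<and>
     (\<forall>a\<in>comm1 \<sigma>. \<forall>c. \<phi> (lscale c a) = c * \<phi> a) \<and>
     (\<forall>a\<in>comm1 \<sigma>. nonneg (\<phi> (lmult \<sigma> (lstar \<sigma> a) a))) \<and>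
     \<phi> lone = 1"

definition is_proj :: "('a::topological_space \<Rightarrow> 'a) \<Rightarrow> ('a elt \<Rightarrow> 'a elt) \<Rightarrow> bool" where
  "is_proj \<sigma> E \<longleftrightarrow>
     (\<forall>a\<in>l1space. \<forall>b\<in>l1space. E (ladd a b) = ladd (E a) (E b)) \<and>
     (\<forall>a\<in>l1space. \<forall>c. E (lscale c a) = lscale c (E a)) \<and>
     (\<forall>a\<in>l1space. E (E a) = E a) \<and>
     E ` l1space = comm1 \<sigma>"

definition is_pos_proj :: "('a::topological_space \<Rightarrow> 'a) \<Rightarrow> ('a elt \<Rightarrow> 'a elt) \<Rightarrow> bool" where
  "is_pos_proj \<sigma> E \<longleftrightarrow> is_proj \<sigma> E \<and>
     (\<forall>a\<in>poscone \<sigma>. \<forall>\<phi>. is_state \<sigma> \<phi> \<longrightarrow> nonneg (\<phi> (E a)))"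

definition faithful :: "('a::topological_space \<Rightarrow> 'a) \<Rightarrow> ('a elt \<Rightarrow> 'a elt) \<Rightarrow> bool" where
  "faithful \<sigma> E \<longleftrightarrow> (\<forall>a\<in>poscone \<sigma>. E a = lzero \<longrightarrow> a = lzero)"

definition involutive :: "('a::topological_space \<Rightarrow> 'a) \<Rightarrow> ('a elt \<Rightarrow> 'a elt) \<Rightarrow> bool" where
  "involutive \<sigma> E \<longleftrightarrow> (\<forall>a\<in>l1space. E (lstar \<sigma> a) = lstar \<sigma> (E a))"

definition norm_one :: "('a::topological_space elt \<Rightarrow> 'a elt) \<Rightarrow> bool" where
  "norm_one E \<longleftrightarrow> (\<forall>a\<in>l1space. l1norm (E a) \<le> l1norm a) \<and>
     (\<exists>a\<in>l1space. a \<noteq> lzero \<and> l1norm (E a) = l1norm a)"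

definition bimodule_morphism :: "('a::topological_space \<Rightarrow> 'a) \<Rightarrow> ('a elt \<Rightarrow> 'a elt) \<Rightarrow> bool" where
  "bimodule_morphism \<sigma> E \<longleftrightarrow> (\<forall>a\<in>comm1 \<sigma>. \<forall>b\<in>comm1 \<sigma>. \<forall>l\<in>l1space.
     E (lmult \<sigma> (lmult \<sigma> a l) b) = lmult \<sigma> (lmult \<sigma> a (E l)) b)"

end

theory Submission
  imports Defs
begin

text \<open>
  The commutant of \<open>C(X)\<close> consists of the \<open>\<Sum>\<^sub>k f\<^sub>k \<delta>\<^sup>k\<close> with \<open>f\<^sub>k\<close> supported in the interior of
  \<open>Fix\<^sub>k\<close>, and on it the product is a pointwise convolution.

  Uniqueness. Let \<open>E\<close> be a positive projection. Compose it with the states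
  \<open>a \<mapsto> a\<^sub>0(x) + (cnj w a\<^sub>n(x) + w a\<^sub>-\<^sub>n(x)) / 2\<close>, \<open>|w| \<le> 1\<close>, which separate the commutant and
  restrict to the character \<open>f \<mapsto> f x\<close> of \<open>C(X)\<close>. By Cauchy-Schwarz \<open>C(X)\<close> lies in the multiplicative domain of
  each composition, so \<open>E\<close> is \<open>C(X)\<close>-linear on both sides. Comparing \<open>g \<delta>\<^sup>k f\<close> with
  \<open>(f \<circ> \<sigma>\<^sup>-\<^sup>k) g \<delta>\<^sup>k\<close> shows that \<open>E (g \<delta>\<^sup>k)\<close> vanishes off the interior of \<open>Fix\<^sub>k\<close>, and on that interior it
  agrees with \<open>g \<delta>\<^sup>k\<close>. For \<open>g = 1\<close> this makes the interior clopen. Passing from finite to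
  infinite sums needs no continuity of \<open>E\<close>: positive functionals are bounded because \<open>1 + a\<close> has
  a self-adjoint square root, given by the binomial series, whenever \<open>a\<close> is self-adjoint of norm
  below 1.

  Existence. For \<open>l\<close> with finite support \<open>K\<close>, group the elements of \<open>K\<close> at each point \<open>x\<close> into
  cosets of the group of all \<open>n\<close> with \<open>x\<close> in the interior of \<open>Fix\<^sub>n\<close>. Splitting \<open>l\<close> along the
  cosets and translating each part back by its least representative writes \<open>E (l\<^sup>* l)\<close> as a
  finite sum of squares from the commutant. The general case follows from boundedness of states.
\<close>

subsection \<open>Unordered sums\<close>

lemma summable_on_norm_comparison:
  fixes f :: "'i \<Rightarrow> 'b::banach"
  assumes "g summable_on A" "\<And>i. i \<in> A \<Longrightarrow> norm (f i) \<le> g i"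
  shows "f summable_on A"
  using Infinite_Sum.abs_summable_on_comparison_test'[OF assms] by (rule abs_summable_summable)

lemma norm_infsum_le_has_sum:
  fixes f :: "'i \<Rightarrow> 'b::banach"
  assumes "(g has_sum S) A" "\<And>i. i \<in> A \<Longrightarrow> norm (f i) \<le> g i"
  shows "norm (infsum f A) \<le> S"
  using summable_on_norm_comparison[OF has_sum_imp_summable[OF assms(1)] assms(2)]
  by (intro norm_infsum_le[OF has_sum_infsum assms])

lemma infsum_eq_single:
  fixes f :: "'i \<Rightarrow> 'b::{comm_monoid_add,t2_space}"
  assumes "\<And>k. k \<noteq> m \<Longrightarrow> f k = 0"
  shows "(\<Sum>\<^sub>\<infinity>k. f k) = f m"
  by (rule infsumI, rule has_sum_finite_neutralI[of "{m}"]) (use assms in auto)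

lemma infsum_times_infsum:
  fixes f :: "'i \<Rightarrow> complex" and g :: "'j \<Rightarrow> complex"
  assumes "(\<lambda>(i, j). f i * g j) summable_on A \<times> B"
  shows "infsum f A * infsum g B = (\<Sum>\<^sub>\<infinity>(i, j)\<in>A \<times> B. f i * g j)"
  by (simp add: infsum_cmult_left' infsum_cmult_right' flip: infsum_Sigma'_banach[OF assms])

lemma has_sum_times_nonneg:
  fixes u :: "'i \<Rightarrow> real" and v :: "'j \<Rightarrow> real"
  assumes u: "(u has_sum U) A" and v: "(v has_sum V) B"
    and nonneg: "\<And>i. 0 \<le> u i" "\<And>j. 0 \<le> v j"
  shows "((\<lambda>(i, j). u i * v j) has_sum U * V) (A \<times> B)"
proof (rule has_sum_SigmaI)
  show inner: "((\<lambda>j. case (i, j) of (i, j) \<Rightarrow> u i * v j) has_sum u i * V) B" for i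
    using has_sum_cmult_right[OF v] by simp
  show outer: "((\<lambda>i. u i * V) has_sum U * V) A"
    by (rule has_sum_cmult_left[OF u])
  show "(\<lambda>(i, j). u i * v j) summable_on A \<times> B"
    by (rule summable_on_SigmaI[OF inner has_sum_imp_summable[OF outer]]) (use nonneg in auto)
qed

lemma has_sum_convolution_pairs:
  fixes u v :: "'g::ab_group_add \<Rightarrow> real"
  assumes "(u has_sum U) UNIV" "(v has_sum V) UNIV" "\<And>i. 0 \<le> u i" "\<And>j. 0 \<le> v j"
  shows "((\<lambda>(n, k). u k * v (n - k)) has_sum U * V) (UNIV \<times> UNIV)"
proof -
  have "((\<lambda>(n, k). u k * v (n - k)) has_sum U * V) (UNIV \<times> UNIV)
    \<longleftrightarrow> ((\<lambda>(i, j). u i * v j) has_sum U * V) (UNIV \<times> UNIV)"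
    by (rule has_sum_reindex_bij_witness[of _ "\<lambda>(i, j). (i + j, i)" "\<lambda>(n, k). (k, n - k)"]) auto
  with has_sum_times_nonneg[OF assms] show ?thesis by simp
qed

lemma summable_on_convolution:
  fixes u v :: "'g::ab_group_add \<Rightarrow> real"
  assumes "(u has_sum U) UNIV" "(v has_sum V) UNIV" "\<And>i. 0 \<le> u i" "\<And>j. 0 \<le> v j"
  shows "(\<lambda>k. u k * v (n - k)) summable_on UNIV"
  using summable_on_SigmaD1[OF has_sum_imp_summable[OF has_sum_convolution_pairs[OF assms]], of n]
  by simp

lemma has_sum_convolution:
  fixes u v :: "'g::ab_group_add \<Rightarrow> real"
  assumes "(u has_sum U) UNIV" "(v has_sum V) UNIV" "\<And>i. 0 \<le> u i" "\<And>j. 0 \<le> v j"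
  shows "((\<lambda>n. \<Sum>\<^sub>\<infinity>k. u k * v (n - k)) has_sum U * V) UNIV"
  by (rule has_sum_Sigma'[OF has_sum_convolution_pairs[OF assms]])
    (use summable_on_convolution[OF assms] in simp)

lemma infsum_nat_pairs_diagonal:
  fixes f :: "nat \<Rightarrow> nat \<Rightarrow> 'b::banach"
  assumes "(\<lambda>(i, j). f i j) summable_on UNIV"
  shows "(\<Sum>\<^sub>\<infinity>(i, j). f i j) = (\<Sum>\<^sub>\<infinity>N. \<Sum>i\<le>N. f i (N - i))"
proof -
  let ?diagonal = "\<lambda>(N, i). f i (N - i)"
  have "(\<lambda>(i, j). f i j) summable_on UNIV \<longleftrightarrow> ?diagonal summable_on (SIGMA N:UNIV. {..N})"
    by (rule summable_on_reindex_bij_witness[of _ "\<lambda>(N, i). (i, N - i)" "\<lambda>(i, j). (i + j, i)"]) auto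
  with assms have summable: "?diagonal summable_on (SIGMA N:UNIV. {..N})" by blast
  have "(\<Sum>\<^sub>\<infinity>(i, j). f i j) = infsum ?diagonal (SIGMA N:UNIV. {..N})"
    by (rule infsum_reindex_bij_witness[of _ "\<lambda>(N, i). (i, N - i)" "\<lambda>(i, j). (i + j, i)"]) auto
  also have "\<dots> = (\<Sum>\<^sub>\<infinity>N. \<Sum>\<^sub>\<infinity>i\<in>{..N}. f i (N - i))"
    by (rule infsum_Sigma'_banach[OF summable, symmetric])
  finally show ?thesis by simp
qed

subsection \<open>Autocorrelation\<close>

definition autocorrelation :: "('g::ab_group_add \<Rightarrow> complex) \<Rightarrow> 'g \<Rightarrow> complex" where
  "autocorrelation c n = (\<Sum>\<^sub>\<infinity>k. cnj (c k) * c (n + k))"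

lemma autocorrelation_0:
  assumes "(\<lambda>k. (cmod (c k))\<^sup>2) summable_on UNIV"
  shows "autocorrelation c 0 = of_real (\<Sum>\<^sub>\<infinity>k. (cmod (c k))\<^sup>2)"
proof -
  have "autocorrelation c 0 = (\<Sum>\<^sub>\<infinity>k. of_real ((cmod (c k))\<^sup>2))"
    unfolding autocorrelation_def
    by (intro infsum_cong) (metis add_0 complex_norm_square mult.commute)
  also have "\<dots> = of_real (\<Sum>\<^sub>\<infinity>k. (cmod (c k))\<^sup>2)"
    using has_sum_infsum[OF assms] by (intro infsumI has_sum_of_real)
  finally show ?thesis .
qed

lemma autocorrelation_uminus: "autocorrelation c (- n) = cnj (autocorrelation c n)"
proof -
  have "autocorrelation c (- n) = (\<Sum>\<^sub>\<infinity>k. cnj (c (k + n)) * c (- n + (k + n)))"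
    unfolding autocorrelation_def by (rule infsum_reindex_bij_betw[OF bij_plus_right, symmetric])
  also have "\<dots> = cnj (autocorrelation c n)"
    by (simp add: autocorrelation_def add.commute mult.commute flip: infsum_cnj)
  finally show ?thesis .
qed

lemma norm_autocorrelation_le:
  assumes summable: "(\<lambda>k. (cmod (c k))\<^sup>2) summable_on UNIV"
  shows "cmod (autocorrelation c n) \<le> (\<Sum>\<^sub>\<infinity>k. (cmod (c k))\<^sup>2)" (is "_ \<le> ?S")
proof -
  let ?mean = "\<lambda>k. 1/2 * ((cmod (c k))\<^sup>2 + (cmod (c (n + k)))\<^sup>2)"
  have "((\<lambda>k. (cmod (c (n + k)))\<^sup>2) has_sum ?S) UNIV"
    using has_sum_infsum[OF summable]
    by (simp only: has_sum_reindex_bij_betw[OF bij_plus, of "\<lambda>k. (cmod (c k))\<^sup>2"])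
  then have "(?mean has_sum 1/2 * (?S + ?S)) UNIV"
    using summable by (intro has_sum_cmult_right has_sum_add has_sum_infsum)
  then have mean: "(?mean has_sum ?S) UNIV" by simp
  have "cmod (cnj (c k) * c (n + k)) \<le> ?mean k" for k
    using sum_squares_bound[of "cmod (c k)" "cmod (c (n + k))"] by (simp add: norm_mult)
  then show ?thesis
    unfolding autocorrelation_def by (intro norm_infsum_le_has_sum[OF mean])
qed

subsection \<open>Nonnegative complex numbers\<close>

lemma nonneg_iff_nonneg_Reals: "nonneg z \<longleftrightarrow> z \<in> \<real>\<^sub>\<ge>\<^sub>0"
  by (auto simp: nonneg_def complex_nonneg_Reals_iff)

lemma closed_nonneg: "closed {z. nonneg z}"
  using closed_nonneg_Reals_complex by (simp add: nonneg_iff_nonneg_Reals)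

lemma nonneg_sum: "(\<And>j. j \<in> K \<Longrightarrow> nonneg (f j)) \<Longrightarrow> nonneg (\<Sum>j\<in>K. f j)"
  by (auto simp: nonneg_def intro: sum_nonneg)

lemma nonneg_quadratic_imp_hermitian:
  assumes nonneg: "\<And>t. nonneg (p + t * u + cnj t * v + t * cnj t * q)" and q: "nonneg q"
  shows "v = cnj u"
  using nonneg[of 0] nonneg[of 1] nonneg[of \<i>] q by (auto simp: nonneg_def complex_eq_iff)

lemma nonneg_quadratic_discriminant:
  assumes nonneg: "\<And>t. nonneg (p + t * u + cnj t * v + t * cnj t * q)" and q: "nonneg q"
  shows "(cmod u)\<^sup>2 \<le> Re p * Re q"
proof -
  have v: "v = cnj u" using nonneg_quadratic_imp_hermitian[OF assms] .
  have quadratic: "0 \<le> Re p + 2 * r * (cmod u)\<^sup>2 + r\<^sup>2 * (cmod u)\<^sup>2 * Re q" for r :: real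
  proof -
    let ?t = "of_real r * cnj u"
    have "p + ?t * u + cnj ?t * v + ?t * cnj ?t * q
        = p + of_real (2 * r) * (u * cnj u) + of_real (r\<^sup>2) * (u * cnj u) * q"
      by (simp add: v power2_eq_square algebra_simps)
    also have "\<dots> = p + of_real (2 * r * (cmod u)\<^sup>2) + of_real (r\<^sup>2 * (cmod u)\<^sup>2) * q"
      by (simp only: flip: complex_norm_square of_real_mult)
    finally show ?thesis using nonneg[of ?t] by (simp only: nonneg_def) simp
  qed
  show ?thesis
  proof (cases "Re q = 0")
    case True
    have "(cmod u)\<^sup>2 = 0"
    proof (rule ccontr)
      assume "(cmod u)\<^sup>2 \<noteq> 0"
      then show False
        using quadratic[of "- (Re p + 1) / (2 * (cmod u)\<^sup>2)"] True by (simp add: field_simps)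
    qed
    with True show ?thesis by simp
  next
    case False
    with q have "0 < Re q" by (simp add: nonneg_def)
    then show ?thesis
      using quadratic[of "- 1 / Re q"] by (simp add: field_simps power2_eq_square)
  qed
qed

subsection \<open>Continuous complex functions\<close>

lemma contfun_const: "contfun (\<lambda>x. c)"
  by (simp add: contfun_def)

lemma contfun_clopen:
  assumes "contfun f" "open S" "closed S"
  shows "contfun (\<lambda>x. if x \<in> S then f x else 0)"
proof -
  have "continuous_on (S \<union> - S) (\<lambda>x. if x \<in> S then f x else 0)"
    by (rule continuous_on_cases)
      (use assms in \<open>auto simp: contfun_def closed_Compl intro: continuous_on_subset\<close>)
  then show ?thesis by (simp add: contfun_def)
qed

lemma contfun_infsum:
  fixes f :: "'i \<Rightarrow> 'a::topological_space \<Rightarrow> complex"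
  assumes "\<And>k. contfun (f k)" "\<And>k x. cmod (f k x) \<le> M k" "M summable_on UNIV"
  shows "contfun (\<lambda>x. \<Sum>\<^sub>\<infinity>k. f k x)"
  unfolding contfun_def
proof (rule uniform_limit_theorem)
  show "uniform_limit UNIV (\<lambda>K x. \<Sum>k\<in>K. f k x) (\<lambda>x. \<Sum>\<^sub>\<infinity>k. f k x) (finite_subsets_at_top UNIV)"
    using assms by (intro Weierstrass_m_test_general) auto
  show "\<forall>\<^sub>F K in finite_subsets_at_top UNIV. continuous_on UNIV (\<lambda>x. \<Sum>k\<in>K. f k x)"
    using assms by (intro always_eventually allI continuous_on_sum) (auto simp: contfun_def)
qed simp

subsection \<open>Coefficients of the square root\<close>

definition sqrt_coeff :: "nat \<Rightarrow> real" where
  "sqrt_coeff n = (1/2) gchoose n"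

lemma abs_sqrt_coeff_le_1: "\<bar>sqrt_coeff n\<bar> \<le> 1"
proof (induction n)
  case (Suc n)
  have "(1/2 - real n) * sqrt_coeff n = real (Suc n) * sqrt_coeff (Suc n)"
    using gbinomial_mult_1[of "1/2 :: real" n] by (simp add: sqrt_coeff_def algebra_simps)
  then have "real (Suc n) * \<bar>sqrt_coeff (Suc n)\<bar> = \<bar>1/2 - real n\<bar> * \<bar>sqrt_coeff n\<bar>"
    by (metis abs_mult abs_of_nat)
  also have "\<dots> \<le> real (Suc n) * 1"
    using Suc by (intro mult_mono) auto
  finally show ?case by (simp del: of_nat_Suc)
qed (simp add: sqrt_coeff_def)

lemma sqrt_coeff_convolution:
  "(\<Sum>n\<le>N. sqrt_coeff n * sqrt_coeff (N - n)) = (if N \<le> 1 then 1 else 0)"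
proof -
  have "(\<Sum>n\<le>N. sqrt_coeff n * sqrt_coeff (N - n)) = real 1 gchoose N"
    unfolding sqrt_coeff_def atMost_atLeast0 gbinomial_Vandermonde by simp
  also have "\<dots> = real (1 choose N)" by (simp only: binomial_gbinomial)
  also have "\<dots> = (if N \<le> 1 then 1 else 0)"
    by (cases "N = 0"; cases "N = 1") (auto simp: binomial_eq_0)
  finally show ?thesis .
qed

lemma sqrt_coeff_summable:
  assumes "0 \<le> q" "q < 1"
  shows "(\<lambda>n. cmod (of_real (sqrt_coeff n)) * q ^ n) summable_on UNIV"
proof (rule summable_on_comparison_test)
  show "(\<lambda>n. q ^ n) summable_on UNIV"
    using assms by (auto intro!: summable_nonneg_imp_summable_on)
  show "cmod (of_real (sqrt_coeff n)) * q ^ n \<le> q ^ n" for n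
    using mult_right_mono[OF abs_sqrt_coeff_le_1, of "q ^ n" n] assms by simp
qed (use assms in auto)

subsection \<open>Integer powers of the dynamics and algebraic identities\<close>

locale bijection_dynamics =
  fixes \<sigma> :: "'a \<Rightarrow> 'a"
  assumes bij_\<sigma>: "bij \<sigma>"
begin

abbreviation iterate :: "int \<Rightarrow> 'a \<Rightarrow> 'a" where "iterate \<equiv> sigpow \<sigma>"
abbreviation mul :: "'a elt \<Rightarrow> 'a elt \<Rightarrow> 'a elt" (infixl "\<odot>" 70) where "a \<odot> b \<equiv> lmult \<sigma> a b"
abbreviation adj :: "'a elt \<Rightarrow> 'a elt" where "adj \<equiv> lstar \<sigma>"

lemma sigpow_0 [simp]: "iterate 0 x = x"
  by (simp add: sigpow_def)

lemma sigpow_succ: "iterate (k + 1) x = \<sigma> (iterate k x)"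
proof (cases "0 \<le> k")
  case True
  then have "nat (k + 1) = Suc (nat k)" by simp
  with True show ?thesis by (simp add: sigpow_def)
next
  case False
  then have "nat (- k) = Suc (nat (- (k + 1)))" by simp
  then have "iterate k x = inv \<sigma> ((inv \<sigma> ^^ nat (- (k + 1))) x)"
    using False by (simp add: sigpow_def)
  moreover have "iterate (k + 1) x = (inv \<sigma> ^^ nat (- (k + 1))) x"
    using False by (cases "k = -1") (auto simp: sigpow_def)
  ultimately show ?thesis
    using bij_\<sigma> by (simp add: bij_is_surj surj_f_inv_f)
qed

lemma sigpow_pred: "iterate (k - 1) x = inv \<sigma> (iterate k x)"
  using sigpow_succ[of "k - 1" x] bij_\<sigma> by (simp add: bij_is_inj)

lemma sigpow_add: "iterate (j + k) x = iterate j (iterate k x)"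
proof (induction j rule: int_induct[where k = 0])
  case (step1 i)
  have "iterate (i + 1 + k) x = \<sigma> (iterate (i + k) x)"
    using sigpow_succ[of "i + k" x] by (simp add: algebra_simps)
  with step1 show ?case by (simp add: sigpow_succ)
next
  case (step2 i)
  have "iterate (i - 1 + k) x = inv \<sigma> (iterate (i + k) x)"
    using sigpow_pred[of "i + k" x] by (simp add: algebra_simps)
  with step2 show ?case by (simp add: sigpow_pred)
qed simp

lemma sigpow_inverse [simp]: "iterate (- k) (iterate k x) = x" "iterate k (iterate (- k) x) = x"
  by (simp_all flip: sigpow_add)

lemma sigpow_commute: "iterate j (iterate k x) = iterate k (iterate j x)"
  by (metis add.commute sigpow_add)

lemma mem_Fix: "x \<in> Fix \<sigma> k \<longleftrightarrow> iterate k x = x"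
  by (simp add: Fix_def)

lemma Fix_0: "Fix \<sigma> 0 = UNIV"
  by (auto simp: mem_Fix)

lemma Fix_minus: "Fix \<sigma> (- k) = Fix \<sigma> k"
  unfolding set_eq_iff mem_Fix by (metis sigpow_inverse)

lemma Fix_add: "Fix \<sigma> j \<inter> Fix \<sigma> k \<subseteq> Fix \<sigma> (j + k)"
  by (auto simp: mem_Fix sigpow_add)

lemma Fix_sigpow: "iterate m x \<in> Fix \<sigma> k \<longleftrightarrow> x \<in> Fix \<sigma> k"
  by (metis mem_Fix sigpow_commute sigpow_inverse(1))

definition single :: "int \<Rightarrow> ('a \<Rightarrow> complex) \<Rightarrow> 'a elt" where
  "single k f = (\<lambda>n. if n = k then f else (\<lambda>x. 0))"

definition series :: "('i \<Rightarrow> 'a elt) \<Rightarrow> 'a elt" where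
  "series u = (\<lambda>k x. \<Sum>\<^sub>\<infinity>i. u i k x)"

primrec lpow :: "'a elt \<Rightarrow> nat \<Rightarrow> 'a elt" where
  "lpow a 0 = lone"
| "lpow a (Suc n) = a \<odot> lpow a n"

definition power_series :: "(nat \<Rightarrow> complex) \<Rightarrow> 'a elt \<Rightarrow> 'a elt" where
  "power_series \<beta> a = series (\<lambda>n. lscale (\<beta> n) (lpow a n))"

lemma emb_eq_single: "emb f = single 0 f"
  by (simp add: emb_def single_def)

lemma emb_lmult: "(emb f \<odot> a) n x = f x * a n x"
  unfolding lmult_def by (subst infsum_eq_single[of 0]) (auto simp: emb_def)

lemma lmult_emb: "(a \<odot> emb f) n x = a n x * f (iterate (- n) x)"
  unfolding lmult_def by (subst infsum_eq_single[of n]) (auto simp: emb_def)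

lemma emb_lmult_emb: "emb f \<odot> emb g = emb (\<lambda>x. f x * g x)"
  by (intro ext) (simp only: emb_lmult, simp add: emb_def)

lemma lone_lmult: "lone \<odot> a = a"
  by (intro ext) (simp add: lone_def emb_lmult)

lemma lmult_lone: "a \<odot> lone = a"
  by (intro ext) (simp add: lone_def lmult_emb)

lemma lmult_lscale_left: "lscale t a \<odot> b = lscale t (a \<odot> b)"
  by (intro ext) (simp add: lmult_def lscale_def mult.assoc infsum_cmult_right')

lemma lmult_lscale_right: "a \<odot> lscale t b = lscale t (a \<odot> b)"
  by (intro ext) (simp add: lmult_def lscale_def mult.left_commute[of _ t] infsum_cmult_right')

lemma lstar_apply: "adj a n x = cnj (a (- n) (iterate (- n) x))"
  by (simp add: lstar_def)

lemma lstar_lstar: "adj (adj a) = a"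
  by (simp add: lstar_def)

lemma lstar_ladd: "adj (ladd a b) = ladd (adj a) (adj b)"
  by (simp add: lstar_def ladd_def)

lemma lstar_lscale: "adj (lscale c a) = lscale (cnj c) (adj a)"
  by (simp add: lstar_def lscale_def)

lemma lstar_emb: "adj (emb f) = emb (\<lambda>x. cnj (f x))"
  by (intro ext) (auto simp: lstar_def emb_def)

lemma lstar_lone: "adj lone = lone"
  by (simp add: lone_def lstar_emb)

lemma lstar_series: "adj (series u) = series (\<lambda>i. adj (u i))"
  by (intro ext) (simp add: lstar_def series_def flip: infsum_cnj)

lemma lstar_lmult: "adj (a \<odot> b) = adj b \<odot> adj a"
proof (intro ext)
  fix n x
  let ?f = "\<lambda>k. adj b k x * adj a (n - k) (iterate (- k) x)"
  have "adj (a \<odot> b) n x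
      = (\<Sum>\<^sub>\<infinity>k. cnj (a k (iterate (- n) x)) * cnj (b (- n - k) (iterate (- k) (iterate (- n) x))))"
    by (simp add: lstar_def lmult_def flip: infsum_cnj)
  also have "\<dots> = (\<Sum>\<^sub>\<infinity>k. ?f (k + n))"
    by (intro infsum_cong) (simp add: lstar_def minus_diff_commute[of _ n] flip: sigpow_add)
  also have "\<dots> = (\<Sum>\<^sub>\<infinity>k. ?f k)"
    by (rule infsum_reindex_bij_betw[OF bij_plus_right])
  also have "\<dots> = (adj b \<odot> adj a) n x" by (simp only: lmult_def)
  finally show "adj (a \<odot> b) n x = (adj b \<odot> adj a) n x" .
qed

lemma lstar_lmult_self:
  "(adj a \<odot> a) n x = (\<Sum>\<^sub>\<infinity>k. cnj (a k (iterate k x)) * a (n + k) (iterate k x))"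
  unfolding lmult_def lstar_def
  by (subst infsum_reindex_bij_betw[OF bij_uminus, symmetric]) simp

definition restr :: "int set \<Rightarrow> 'a elt \<Rightarrow> 'a elt" where
  "restr K a = (\<lambda>k. if k \<in> K then a k else (\<lambda>x. 0))"

lemma restr_split: "ladd (restr K a) (restr (- K) a) = a"
  by (intro ext) (simp add: restr_def ladd_def)

end

locale homeomorphism_dynamics = bijection_dynamics \<sigma>
  for \<sigma> :: "'a::topological_space \<Rightarrow> 'a" +
  assumes cont_\<sigma>: "continuous_on UNIV \<sigma>"
    and cont_inv_\<sigma>: "continuous_on UNIV (inv \<sigma>)"
begin

lemma continuous_sigpow: "continuous_on UNIV (iterate k)"
proof (induction k rule: int_induct[where k = 0])
  case base
  show ?case by (simp cong: continuous_on_cong)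
next
  case (step1 i)
  have "iterate (i + 1) = \<sigma> \<circ> iterate i" by (auto simp: sigpow_succ)
  with step1 cont_\<sigma> show ?case
    by (metis continuous_on_compose continuous_on_subset subset_UNIV)
next
  case (step2 i)
  have "iterate (i - 1) = inv \<sigma> \<circ> iterate i" by (auto simp: sigpow_pred)
  with step2 cont_inv_\<sigma> show ?case
    by (metis continuous_on_compose continuous_on_subset subset_UNIV)
qed

lemma contfun_sigpow: "contfun f \<Longrightarrow> contfun (\<lambda>x. f (iterate k x))"
  unfolding contfun_def by (rule continuous_on_compose2[OF _ continuous_sigpow]) auto

abbreviation FixI :: "int \<Rightarrow> 'a set" where "FixI k \<equiv> interior (Fix \<sigma> k)"

lemma FixI_imp_fixed: "x \<in> FixI k \<Longrightarrow> iterate k x = x"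
  using interior_subset mem_Fix by blast

lemma FixI_0: "x \<in> FixI 0"
  by (simp add: Fix_0)

lemma FixI_minus: "FixI (- k) = FixI k"
  by (simp add: Fix_minus)

lemma FixI_add: "x \<in> FixI j \<Longrightarrow> x \<in> FixI k \<Longrightarrow> x \<in> FixI (j + k)"
  using interior_mono[OF Fix_add[of j k]] by auto

lemma FixI_diff: "x \<in> FixI j \<Longrightarrow> x \<in> FixI k \<Longrightarrow> x \<in> FixI (j - k)"
  using FixI_add[of x j "- k"] by (simp add: FixI_minus)

lemma FixI_diff_iff: "x \<in> FixI k \<Longrightarrow> x \<in> FixI (n - k) \<longleftrightarrow> x \<in> FixI n"
  using FixI_add[of x "n - k" k] FixI_diff[of x n k] by auto

lemma FixI_sigpow: "iterate m x \<in> FixI k \<longleftrightarrow> x \<in> FixI k"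
proof -
  have invariant: "y \<in> FixI k" if "iterate j y \<in> FixI k" for j y
  proof -
    have "open (iterate j -` FixI k)"
      using continuous_sigpow by (simp add: open_vimage)
    moreover have "iterate j -` FixI k \<subseteq> Fix \<sigma> k"
      using interior_subset Fix_sigpow by blast
    ultimately have "iterate j -` FixI k \<subseteq> FixI k" by (rule interior_maximal[rotated])
    with that show ?thesis by blast
  qed
  show ?thesis using invariant[of m x] invariant[of "- m" "iterate m x"] by auto
qed

definition condexp :: "'a elt \<Rightarrow> 'a elt" where
  "condexp a = (\<lambda>k x. indicator (FixI k) x * a k x)"

lemma condexp_ladd: "condexp (ladd a b) = ladd (condexp a) (condexp b)"
  by (simp add: condexp_def ladd_def algebra_simps)

lemma condexp_lscale: "condexp (lscale c a) = lscale c (condexp a)"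
  by (simp add: condexp_def lscale_def algebra_simps)

lemma condexp_condexp: "condexp (condexp a) = condexp a"
  by (intro ext) (simp add: condexp_def indicator_def)

lemma condexp_lstar: "condexp (adj a) = adj (condexp a)"
  by (intro ext) (auto simp: condexp_def lstar_def indicator_def FixI_minus FixI_sigpow)

lemma condexp_eq_self_iff: "condexp a = a \<longleftrightarrow> (\<forall>k x. a k x \<noteq> 0 \<longrightarrow> x \<in> FixI k)"
  by (auto simp: condexp_def fun_eq_iff indicator_def)

end

subsection \<open>The Banach *-algebra\<close>

locale compact_dynamics = homeomorphism_dynamics +
  assumes compact_UNIV: "compact (UNIV :: 'a set)"
begin

lemma bdd_above_cmod:
  fixes f :: "'a \<Rightarrow> complex"
  assumes "contfun f" shows "bdd_above (range (\<lambda>x. cmod (f x)))"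
proof -
  have "compact (range (\<lambda>x. cmod (f x)))"
    using assms compact_UNIV unfolding contfun_def
    by (intro compact_continuous_image continuous_intros)
  then show ?thesis by (simp add: bounded_imp_bdd_above compact_imp_bounded)
qed

lemma cmod_le_supnorm:
  fixes f :: "'a \<Rightarrow> complex"
  shows "contfun f \<Longrightarrow> cmod (f x) \<le> supnorm f"
  unfolding supnorm_def by (rule cSUP_upper[OF _ bdd_above_cmod]) auto

lemma supnorm_le: "(\<And>x. cmod (f x) \<le> M) \<Longrightarrow> supnorm f \<le> M"
  unfolding supnorm_def by (rule cSUP_least) auto

lemma supnorm_nonneg:
  fixes f :: "'a \<Rightarrow> complex"
  shows "contfun f \<Longrightarrow> 0 \<le> supnorm f"
  using cmod_le_supnorm[of f undefined] norm_ge_zero order_trans by blast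

lemma l1_contfun: "a \<in> l1space \<Longrightarrow> contfun (a k)"
  by (simp add: l1space_def)

lemma l1_supnorm_nonneg: "(a :: 'a elt) \<in> l1space \<Longrightarrow> 0 \<le> supnorm (a k)"
  by (simp add: l1space_def supnorm_nonneg)

lemma l1_cmod_le: "(a :: 'a elt) \<in> l1space \<Longrightarrow> cmod (a k x) \<le> supnorm (a k)"
  by (simp add: l1space_def cmod_le_supnorm)

lemma l1norm_has_sum: "a \<in> l1space \<Longrightarrow> ((\<lambda>k. supnorm (a k)) has_sum l1norm a) UNIV"
  by (simp add: l1space_def l1norm_def)

lemmas l1_summable = has_sum_imp_summable[OF l1norm_has_sum]

lemma l1norm_nonneg: "(a :: 'a elt) \<in> l1space \<Longrightarrow> 0 \<le> l1norm a"
  by (rule has_sum_nonneg[OF l1norm_has_sum]) (simp_all add: l1_supnorm_nonneg)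

lemma supnorm_le_l1norm: "(a :: 'a elt) \<in> l1space \<Longrightarrow> supnorm (a k) \<le> l1norm a"
  using finite_sum_le_has_sum[OF l1norm_has_sum, of a "{k}"] by (simp add: l1_supnorm_nonneg)

lemma cmod_le_l1norm: "(a :: 'a elt) \<in> l1space \<Longrightarrow> cmod (a k x) \<le> l1norm a"
  using l1_cmod_le supnorm_le_l1norm order_trans by blast

lemma l1_dominated:
  fixes a :: "'a elt"
  assumes cont: "\<And>k. contfun (a k)" and bound: "\<And>k x. cmod (a k x) \<le> M k"
    and M: "(M has_sum S) UNIV"
  shows "a \<in> l1space" "l1norm a \<le> S"
proof -
  have "(\<lambda>k. supnorm (a k)) summable_on UNIV"
    by (rule summable_on_comparison_test[OF has_sum_imp_summable[OF M]])
      (use cont bound in \<open>auto intro: supnorm_le supnorm_nonneg\<close>)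
  then show "a \<in> l1space" using cont by (simp add: l1space_def)
  then show "l1norm a \<le> S"
    by (rule has_sum_mono[OF l1norm_has_sum M]) (use bound in \<open>auto intro: supnorm_le\<close>)
qed

lemma single_l1:
  assumes f: "contfun f"
  shows "single k f \<in> l1space" "l1norm (single k f) \<le> supnorm f"
proof -
  have cont: "contfun (single k f n)" for n
    using f by (simp add: single_def contfun_const)
  have bound: "cmod (single k f n x) \<le> (if n = k then supnorm f else 0)" for n x
    using cmod_le_supnorm[OF f] by (simp add: single_def)
  have "((\<lambda>n. if n = k then supnorm f else 0) has_sum supnorm f) UNIV"
    by (rule has_sum_finite_neutralI[of "{k}"]) auto
  then show "single k f \<in> l1space" "l1norm (single k f) \<le> supnorm f"
    by (rule l1_dominated[OF cont bound])+
qed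

lemma emb_l1: "contfun (f :: 'a \<Rightarrow> complex) \<Longrightarrow> emb f \<in> l1space"
  by (simp add: emb_eq_single single_l1)

lemma lone_l1: "(lone :: 'a elt) \<in> l1space"
  by (simp add: lone_def emb_l1 contfun_const)

lemma l1norm_lone: "l1norm (lone :: 'a elt) \<le> 1"
  unfolding lone_def emb_eq_single
  by (rule order_trans[OF single_l1(2)]) (auto intro: contfun_const supnorm_le)

lemma ladd_l1:
  fixes a b :: "'a elt"
  assumes a: "a \<in> l1space" and b: "b \<in> l1space"
  shows "ladd a b \<in> l1space" "l1norm (ladd a b) \<le> l1norm a + l1norm b"
proof -
  have cont: "contfun (ladd a b k)" for k
    using l1_contfun[OF a] l1_contfun[OF b]
    by (auto simp: contfun_def ladd_def intro!: continuous_intros)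
  have bound: "cmod (ladd a b k x) \<le> supnorm (a k) + supnorm (b k)" for k x
    unfolding ladd_def using l1_cmod_le[OF a] l1_cmod_le[OF b] by (meson add_mono norm_triangle_le)
  show "ladd a b \<in> l1space" "l1norm (ladd a b) \<le> l1norm a + l1norm b"
    by (rule l1_dominated[OF cont bound has_sum_add[OF l1norm_has_sum[OF a] l1norm_has_sum[OF b]]])+
qed

lemma lscale_l1:
  fixes a :: "'a elt"
  assumes a: "a \<in> l1space"
  shows "lscale c a \<in> l1space" "l1norm (lscale c a) \<le> cmod c * l1norm a"
proof -
  have cont: "contfun (lscale c a k)" for k
    using l1_contfun[OF a] by (auto simp: contfun_def lscale_def intro!: continuous_intros)
  have bound: "cmod (lscale c a k x) \<le> cmod c * supnorm (a k)" for k x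
    unfolding lscale_def norm_mult using l1_cmod_le[OF a] by (simp add: mult_left_mono)
  show "lscale c a \<in> l1space" "l1norm (lscale c a) \<le> cmod c * l1norm a"
    by (rule l1_dominated[OF cont bound has_sum_cmult_right[OF l1norm_has_sum[OF a]]])+
qed

lemma lstar_l1:
  assumes a: "a \<in> l1space"
  shows "adj a \<in> l1space" "l1norm (adj a) \<le> l1norm a"
proof -
  have cont: "contfun (adj a n)" for n
    using contfun_sigpow[OF l1_contfun[OF a]]
    unfolding lstar_def contfun_def by (intro continuous_intros)
  have bound: "cmod (adj a n x) \<le> supnorm (a (- n))" for n x
    using l1_cmod_le[OF a] by (simp add: lstar_def)
  have "((\<lambda>n. supnorm (a (- n))) has_sum l1norm a) UNIV"
    using l1norm_has_sum[OF a]
    by (simp only: has_sum_reindex_bij_betw[OF bij_uminus, of "\<lambda>k. supnorm (a k)"])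
  then show "adj a \<in> l1space" "l1norm (adj a) \<le> l1norm a"
    by (rule l1_dominated[OF cont bound])+
qed

lemma restr_l1:
  assumes a: "a \<in> l1space"
  shows "restr K a \<in> l1space" "l1norm (restr K a) \<le> l1norm a"
proof -
  have cont: "contfun (restr K a k)" for k
    using l1_contfun[OF a] by (simp add: restr_def contfun_const)
  have bound: "cmod (restr K a k x) \<le> supnorm (a k)" for k x
    using l1_cmod_le[OF a] l1_supnorm_nonneg[OF a] by (simp add: restr_def)
  show "restr K a \<in> l1space" "l1norm (restr K a) \<le> l1norm a"
    by (rule l1_dominated[OF cont bound l1norm_has_sum[OF a]])+
qed

lemma restr_tail_small:
  assumes a: "a \<in> l1space" and "0 < e"
  obtains K where "finite K" "l1norm (restr (- K) a) \<le> e"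
proof -
  let ?f = "\<lambda>k. supnorm (a k)"
  obtain K where K: "finite K" "dist (sum ?f K) (l1norm a) \<le> e"
    using has_sum_finite_approximation[OF l1norm_has_sum[OF a] \<open>0 < e\<close>] by auto
  have "(?f has_sum l1norm a - sum ?f K) (UNIV - K)"
    by (rule has_sum_Diff[OF l1norm_has_sum[OF a] has_sum_finite[OF K(1)]]) simp
  also have "?this \<longleftrightarrow> ((\<lambda>k. if k \<in> K then 0 else ?f k) has_sum l1norm a - sum ?f K) UNIV"
    by (rule has_sum_cong_neutral) auto
  finally have tail: "((\<lambda>k. if k \<in> K then 0 else ?f k) has_sum l1norm a - sum ?f K) UNIV" .
  have "l1norm (restr (- K) a) \<le> l1norm a - sum ?f K"
    by (rule l1_dominated(2)[OF _ _ tail])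
      (use l1_contfun[OF a] l1_cmod_le[OF a] in \<open>auto simp: restr_def contfun_const\<close>)
  also have "\<dots> \<le> e" using K(2) by (simp add: dist_real_def)
  finally show thesis using that K(1) by blast
qed

lemma cmod_lmult_term_le:
  fixes a b :: "'a elt"
  assumes "a \<in> l1space" "b \<in> l1space"
  shows "cmod (a k x * b l y) \<le> supnorm (a k) * supnorm (b l)"
  unfolding norm_mult by (intro mult_mono l1_cmod_le assms l1_supnorm_nonneg) auto

lemma supnorm_convolution_summable:
  fixes a b :: "'a elt"
  assumes "a \<in> l1space" "b \<in> l1space"
  shows "(\<lambda>k. supnorm (a k) * supnorm (b (n - k))) summable_on UNIV"
  using assms
  by (intro summable_on_convolution[OF l1norm_has_sum l1norm_has_sum] l1_supnorm_nonneg)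

lemma lmult_summable:
  fixes a b :: "'a elt"
  assumes "a \<in> l1space" "b \<in> l1space"
  shows "(\<lambda>k. a k x * b (n - k) (y k)) summable_on UNIV"
  by (rule summable_on_norm_comparison[OF supnorm_convolution_summable[OF assms, of n]])
    (rule cmod_lmult_term_le[OF assms])

lemma lmult_l1:
  assumes a: "a \<in> l1space" and b: "b \<in> l1space"
  shows "a \<odot> b \<in> l1space" "l1norm (a \<odot> b) \<le> l1norm a * l1norm b"
proof -
  note summable = supnorm_convolution_summable[OF a b]
  have cont: "contfun ((a \<odot> b) n)" for n
    unfolding lmult_def
  proof (rule contfun_infsum[OF _ cmod_lmult_term_le[OF a b] summable])
    show "contfun (\<lambda>x. a k x * b (n - k) (iterate (- k) x))" for k
      using contfun_sigpow[OF l1_contfun[OF b]] l1_contfun[OF a]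
      by (auto simp: contfun_def intro!: continuous_intros)
  qed
  have bound: "cmod ((a \<odot> b) n x) \<le> (\<Sum>\<^sub>\<infinity>k. supnorm (a k) * supnorm (b (n - k)))" for n x
    unfolding lmult_def
    by (rule norm_infsum_le_has_sum[OF has_sum_infsum[OF summable] cmod_lmult_term_le[OF a b]])
  have "((\<lambda>n. \<Sum>\<^sub>\<infinity>k. supnorm (a k) * supnorm (b (n - k))) has_sum l1norm a * l1norm b) UNIV"
    using a b by (intro has_sum_convolution l1norm_has_sum l1_supnorm_nonneg)
  then show "a \<odot> b \<in> l1space" "l1norm (a \<odot> b) \<le> l1norm a * l1norm b"
    by (rule l1_dominated[OF cont bound])+
qed

lemma lmult_ladd_left:
  assumes "a \<in> l1space" "b \<in> l1space" "c \<in> l1space"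
  shows "ladd a b \<odot> c = ladd (a \<odot> c) (b \<odot> c)"
  unfolding lmult_def ladd_def ring_distribs by (intro ext infsum_add lmult_summable assms)

lemma lmult_ladd_right:
  assumes "a \<in> l1space" "b \<in> l1space" "c \<in> l1space"
  shows "c \<odot> ladd a b = ladd (c \<odot> a) (c \<odot> b)"
  unfolding lmult_def ladd_def ring_distribs by (intro ext infsum_add lmult_summable assms)

lemma lmult_assoc:
  assumes a: "a \<in> l1space" and b: "b \<in> l1space" and c: "c \<in> l1space"
  shows "(a \<odot> b) \<odot> c = a \<odot> (b \<odot> c)"
proof (intro ext)
  fix n x
  define t where "t j k = a k x * b (j - k) (iterate (- k) x) * c (n - j) (iterate (- j) x)" for j k
  let ?bound = "\<lambda>(j, k). supnorm (a k) * supnorm (b (j - k))"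
  have "?bound summable_on UNIV \<times> UNIV"
    using has_sum_convolution_pairs[OF l1norm_has_sum[OF a] l1norm_has_sum[OF b]] a b
    by (simp add: has_sum_imp_summable l1_supnorm_nonneg)
  then have "(\<lambda>p. ?bound p * l1norm c) summable_on UNIV \<times> UNIV"
    by (rule summable_on_cmult_left)
  moreover have "cmod (case p of (j, k) \<Rightarrow> t j k) \<le> ?bound p * l1norm c" for p
    unfolding t_def case_prod_beta norm_mult[of "_ * _"]
    by (intro mult_mono cmod_lmult_term_le cmod_le_l1norm mult_nonneg_nonneg l1_supnorm_nonneg
        a b c) simp
  ultimately have summable: "(\<lambda>(j, k). t j k) summable_on UNIV \<times> UNIV"
    by (rule summable_on_norm_comparison)
  have "((a \<odot> b) \<odot> c) n x = (\<Sum>\<^sub>\<infinity>j. \<Sum>\<^sub>\<infinity>k. t j k)"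
    by (simp add: lmult_def t_def flip: infsum_cmult_left')
  also have "\<dots> = (\<Sum>\<^sub>\<infinity>k. \<Sum>\<^sub>\<infinity>j. t j k)"
    by (rule infsum_swap_banach[OF summable])
  also have "\<dots> = (\<Sum>\<^sub>\<infinity>k. \<Sum>\<^sub>\<infinity>i. t (i + k) k)"
    by (simp only: infsum_reindex_bij_betw[OF bij_plus_right, of "\<lambda>j. t j k" k for k])
  also have "\<dots> = (a \<odot> (b \<odot> c)) n x"
    by (simp add: lmult_def t_def sigpow_add[of "- i" "- k" for i k] algebra_simps
        flip: infsum_cmult_right' sigpow_add)
  finally show "((a \<odot> b) \<odot> c) n x = (a \<odot> (b \<odot> c)) n x" .
qed

lemma l1_square_summable:
  fixes a :: "'a elt"
  assumes "a \<in> l1space" shows "(\<lambda>k. (cmod (a k (y k)))\<^sup>2) summable_on UNIV"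
proof (rule summable_on_comparison_test)
  show "(\<lambda>k. l1norm a * supnorm (a k)) summable_on UNIV"
    by (intro summable_on_cmult_right l1_summable assms)
  show "(cmod (a k (y k)))\<^sup>2 \<le> l1norm a * supnorm (a k)" for k
    unfolding power2_eq_square
    by (intro mult_mono cmod_le_l1norm l1_cmod_le l1norm_nonneg assms) auto
qed auto

lemma lstar_lmult_self_ladd:
  assumes p: "p \<in> l1space" and r: "r \<in> l1space"
  obtains z where "z \<in> l1space" "adj (ladd p r) \<odot> ladd p r = ladd (adj p \<odot> p) z"
    "l1norm z \<le> l1norm r * (l1norm p + l1norm (ladd p r))"
proof
  let ?l = "ladd p r" and ?z = "ladd (adj p \<odot> r) (adj r \<odot> ladd p r)"
  note l1 = p r ladd_l1(1) lstar_l1(1) lmult_l1(1)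
  show "?z \<in> l1space" by (intro l1)
  have "adj ?l \<odot> ?l = ladd (adj p \<odot> ?l) (adj r \<odot> ?l)"
    by (simp add: lstar_ladd lmult_ladd_left l1)
  also have "adj p \<odot> ?l = ladd (adj p \<odot> p) (adj p \<odot> r)"
    by (simp add: lmult_ladd_right l1)
  finally show "adj ?l \<odot> ?l = ladd (adj p \<odot> p) ?z"
    by (simp add: ladd_def add.assoc)
  have "l1norm ?z \<le> l1norm (adj p \<odot> r) + l1norm (adj r \<odot> ?l)"
    by (intro ladd_l1(2) l1)
  also have "\<dots> \<le> l1norm (adj p) * l1norm r + l1norm (adj r) * l1norm ?l"
    by (intro add_mono lmult_l1(2) l1)
  also have "\<dots> \<le> l1norm p * l1norm r + l1norm r * l1norm ?l"
    by (intro add_mono mult_right_mono lstar_l1(2) l1norm_nonneg l1)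
  finally show "l1norm ?z \<le> l1norm r * (l1norm p + l1norm ?l)" by (simp add: algebra_simps)
qed

end

subsection \<open>Absolutely convergent series\<close>

context compact_dynamics
begin

lemma series_coeff_summable:
  fixes u :: "'i \<Rightarrow> 'a elt"
  assumes "\<And>i. u i \<in> l1space" "(\<lambda>i. l1norm (u i)) summable_on UNIV"
  shows "(\<lambda>i. u i k x) summable_on UNIV"
  by (rule summable_on_norm_comparison[OF assms(2)]) (simp add: cmod_le_l1norm assms(1))

lemma supnorm_pairs_summable:
  fixes u :: "'i \<Rightarrow> 'a elt"
  assumes u: "\<And>i. u i \<in> l1space" "(\<lambda>i. l1norm (u i)) summable_on UNIV"
  shows "(\<lambda>(k, i). supnorm (u i k)) summable_on UNIV \<times> UNIV"
proof -
  have "(\<lambda>(i, k). supnorm (u i k)) summable_on UNIV \<times> UNIV"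
    by (rule summable_on_SigmaI[where g = "\<lambda>i. l1norm (u i)"])
      (use u l1norm_has_sum l1_supnorm_nonneg in auto)
  then show ?thesis by (subst summable_on_swap) simp
qed

lemma series_l1:
  fixes u :: "'i \<Rightarrow> 'a elt"
  assumes u: "\<And>i. u i \<in> l1space" "(\<lambda>i. l1norm (u i)) summable_on UNIV"
  shows "series u \<in> l1space"
proof -
  note summable = supnorm_pairs_summable[OF u]
  have "(\<lambda>i. supnorm (u i k)) summable_on UNIV" for k
    using summable_on_SigmaD1[OF summable] by simp
  then have "cmod (series u k x) \<le> (\<Sum>\<^sub>\<infinity>i. supnorm (u i k))" for k x
    unfolding series_def using u(1)
    by (intro norm_infsum_le_has_sum[OF has_sum_infsum]) (auto intro: l1_cmod_le)
  moreover have "contfun (series u k)" for k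
    unfolding series_def
    by (rule contfun_infsum[OF _ _ u(2)]) (use u(1) in \<open>auto intro: l1_contfun cmod_le_l1norm\<close>)
  ultimately show ?thesis
    using l1_dominated(1)[OF _ _ has_sum_infsum[OF summable_on_Sigma_banach[OF summable]]] by blast
qed

lemma lmult_pairs_summable:
  fixes u :: "'i \<Rightarrow> 'a elt" and v :: "'j \<Rightarrow> 'a elt"
  assumes u: "\<And>i. u i \<in> l1space" "(\<lambda>i. l1norm (u i)) summable_on UNIV"
    and v: "\<And>j. v j \<in> l1space" "(\<lambda>j. l1norm (v j)) summable_on UNIV"
  shows "(\<lambda>(i, j). l1norm (u i \<odot> v j)) summable_on UNIV"
proof (rule summable_on_comparison_test)
  show "(\<lambda>(i, j). l1norm (u i) * l1norm (v j)) summable_on UNIV"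
    using has_sum_times_nonneg[OF has_sum_infsum[OF u(2)] has_sum_infsum[OF v(2)]] u(1) v(1)
    by (simp add: has_sum_imp_summable l1norm_nonneg)
qed (use u(1) v(1) in \<open>auto intro: lmult_l1 l1norm_nonneg\<close>)

lemma lmult_series:
  fixes u :: "'i \<Rightarrow> 'a elt" and v :: "'j \<Rightarrow> 'a elt"
  assumes u: "\<And>i. u i \<in> l1space" "(\<lambda>i. l1norm (u i)) summable_on UNIV"
    and v: "\<And>j. v j \<in> l1space" "(\<lambda>j. l1norm (v j)) summable_on UNIV"
  shows "series u \<odot> series v = series (\<lambda>(i, j). u i \<odot> v j)"
proof (intro ext)
  fix n x
  let ?t = "\<lambda>k (i, j). u i k x * v j (n - k) (iterate (- k) x)"
  have "(\<lambda>(p, j). (case p of (k, i) \<Rightarrow> supnorm (u i k)) * l1norm (v j)) summable_on UNIV \<times> UNIV"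
    using has_sum_times_nonneg[OF has_sum_infsum[OF supnorm_pairs_summable[OF u]]
        has_sum_infsum[OF v(2)]] u(1) v(1)
    by (auto intro!: has_sum_imp_summable l1norm_nonneg l1_supnorm_nonneg)
  also have "?this \<longleftrightarrow> (\<lambda>(k, i, j). supnorm (u i k) * l1norm (v j)) summable_on UNIV \<times> UNIV"
    by (rule summable_on_reindex_bij_witness[of _
          "\<lambda>(k, i, j). ((k, i), j)" "\<lambda>((k, i), j). (k, i, j)"]) auto
  finally have bound: "(\<lambda>(k, i, j). supnorm (u i k) * l1norm (v j)) summable_on UNIV \<times> UNIV" .
  have summable: "(\<lambda>(k, p). ?t k p) summable_on UNIV \<times> UNIV"
    by (rule summable_on_norm_comparison[OF bound])
      (auto simp: norm_mult intro!: mult_mono l1_cmod_le cmod_le_l1norm l1_supnorm_nonneg u(1) v(1))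
  have "(series u \<odot> series v) n x = (\<Sum>\<^sub>\<infinity>k. \<Sum>\<^sub>\<infinity>p. ?t k p)"
    unfolding lmult_def series_def using summable_on_SigmaD1[OF summable]
    by (subst infsum_times_infsum) auto
  also have "\<dots> = (\<Sum>\<^sub>\<infinity>p. \<Sum>\<^sub>\<infinity>k. ?t k p)"
    by (rule infsum_swap_banach[OF summable])
  also have "\<dots> = series (\<lambda>(i, j). u i \<odot> v j) n x"
    by (simp add: series_def lmult_def case_prod_beta)
  finally show "(series u \<odot> series v) n x = series (\<lambda>(i, j). u i \<odot> v j) n x" .
qed

subsection \<open>Power series and square roots\<close>

lemma lpow_l1:
  assumes a: "a \<in> l1space"
  shows "lpow a n \<in> l1space" "l1norm (lpow a n) \<le> l1norm a ^ n"
proof -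
  show l1: "lpow a n \<in> l1space" for n
    by (induction n) (simp_all add: lone_l1 lmult_l1 a)
  show "l1norm (lpow a n) \<le> l1norm a ^ n"
  proof (induction n)
    case (Suc n)
    have "l1norm (lpow a (Suc n)) \<le> l1norm a * l1norm (lpow a n)"
      using a l1 by (simp add: lmult_l1)
    also have "\<dots> \<le> l1norm a * l1norm a ^ n"
      using Suc a by (intro mult_left_mono l1norm_nonneg)
    finally show ?case by simp
  qed (simp add: l1norm_lone)
qed

lemma lpow_add: "a \<in> l1space \<Longrightarrow> lpow a (m + n) = lpow a m \<odot> lpow a n"
  by (induction m) (simp_all add: lone_lmult lmult_assoc lpow_l1)

lemma lstar_lpow:
  assumes a: "a \<in> l1space" shows "adj (lpow a n) = lpow (adj a) n"
proof (induction n)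
  case (Suc n)
  have "adj (lpow a (Suc n)) = lpow (adj a) n \<odot> lpow (adj a) 1"
    using Suc by (simp add: lstar_lmult lmult_lone)
  also have "\<dots> = lpow (adj a) (Suc n)"
    using lpow_add[OF lstar_l1(1)[OF a], of n 1] by simp
  finally show ?case .
qed (simp add: lstar_lone)

lemma power_series_term_l1:
  "a \<in> l1space \<Longrightarrow> lscale (\<beta> n) (lpow a n) \<in> l1space"
  by (simp add: lscale_l1 lpow_l1)

lemma power_series_summable:
  assumes a: "a \<in> l1space" and \<beta>: "(\<lambda>n. cmod (\<beta> n) * l1norm a ^ n) summable_on UNIV"
  shows "(\<lambda>n. l1norm (lscale (\<beta> n) (lpow a n))) summable_on UNIV"
proof (rule summable_on_comparison_test[OF \<beta>])
  fix n
  have "l1norm (lscale (\<beta> n) (lpow a n)) \<le> cmod (\<beta> n) * l1norm (lpow a n)"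
    using a by (simp add: lscale_l1 lpow_l1)
  also have "\<dots> \<le> cmod (\<beta> n) * l1norm a ^ n"
    using a by (simp add: mult_left_mono lpow_l1)
  finally show "l1norm (lscale (\<beta> n) (lpow a n)) \<le> cmod (\<beta> n) * l1norm a ^ n" .
qed (simp add: a power_series_term_l1 l1norm_nonneg)

lemma lstar_power_series:
  "a \<in> l1space \<Longrightarrow> adj (power_series \<beta> a) = power_series (\<lambda>n. cnj (\<beta> n)) (adj a)"
  by (simp add: power_series_def lstar_series lstar_lscale lstar_lpow)

lemma power_series_lmult:
  assumes a: "a \<in> l1space"
    and \<beta>: "(\<lambda>n. cmod (\<beta> n) * l1norm a ^ n) summable_on UNIV"
    and \<gamma>: "(\<lambda>n. cmod (\<gamma> n) * l1norm a ^ n) summable_on UNIV"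
  shows "power_series \<beta> a \<odot> power_series \<gamma> a = power_series (\<lambda>N. \<Sum>i\<le>N. \<beta> i * \<gamma> (N - i)) a"
proof (intro ext)
  fix n x
  let ?u = "\<lambda>i. lscale (\<beta> i) (lpow a i)" and ?v = "\<lambda>j. lscale (\<gamma> j) (lpow a j)"
  note u = power_series_term_l1[OF a, of \<beta>] power_series_summable[OF a \<beta>]
  note v = power_series_term_l1[OF a, of \<gamma>] power_series_summable[OF a \<gamma>]
  have product: "(?u i \<odot> ?v j) n x = \<beta> i * \<gamma> j * lpow a (i + j) n x" for i j
    by (simp only: lmult_lscale_left lmult_lscale_right lpow_add[OF a, symmetric])
      (simp add: lscale_def)
  have "(\<lambda>p. (case p of (i, j) \<Rightarrow> ?u i \<odot> ?v j) n x) summable_on UNIV"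
    using lmult_pairs_summable[OF u v] u(1) v(1)
    by (intro series_coeff_summable) (simp_all add: case_prod_unfold lmult_l1)
  then have summable: "(\<lambda>(i, j). \<beta> i * \<gamma> j * lpow a (i + j) n x) summable_on UNIV"
    by (simp add: case_prod_unfold product)
  have "(power_series \<beta> a \<odot> power_series \<gamma> a) n x
      = (\<Sum>\<^sub>\<infinity>(i, j). \<beta> i * \<gamma> j * lpow a (i + j) n x)"
    unfolding power_series_def
    by (subst lmult_series[OF u v]) (simp add: series_def case_prod_unfold product)
  also have "\<dots> = (\<Sum>\<^sub>\<infinity>N. \<Sum>i\<le>N. \<beta> i * \<gamma> (N - i) * lpow a (i + (N - i)) n x)"
    by (rule infsum_nat_pairs_diagonal[OF summable])
  also have "\<dots> = power_series (\<lambda>N. \<Sum>i\<le>N. \<beta> i * \<gamma> (N - i)) a n x"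
    by (simp add: power_series_def series_def lscale_def sum_distrib_right)
  finally show "(power_series \<beta> a \<odot> power_series \<gamma> a) n x
      = power_series (\<lambda>N. \<Sum>i\<le>N. \<beta> i * \<gamma> (N - i)) a n x" .
qed

lemma power_series_one_plus:
  "power_series (\<lambda>N. if N \<le> 1 then 1 else 0) a = ladd lone a"
proof (intro ext)
  fix n x
  have "power_series (\<lambda>N. if N \<le> 1 then 1 else 0) a n x = (\<Sum>\<^sub>\<infinity>N\<in>{0, 1}. lpow a N n x)"
    unfolding power_series_def series_def by (rule infsum_cong_neutral) (auto simp: lscale_def)
  then show "power_series (\<lambda>N. if N \<le> 1 then 1 else 0) a n x = ladd lone a n x"
    by (simp add: ladd_def lmult_lone)
qed

lemma power_series_sqrt_lmult_self:
  assumes a: "a \<in> l1space" "l1norm a < 1"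
  shows "power_series (\<lambda>n. of_real (sqrt_coeff n)) a \<odot> power_series (\<lambda>n. of_real (sqrt_coeff n)) a
    = ladd lone a"
proof -
  note summable = sqrt_coeff_summable[OF l1norm_nonneg[OF a(1)] a(2)]
  have "(\<Sum>i\<le>N. of_real (sqrt_coeff i) * of_real (sqrt_coeff (N - i)))
      = (if N \<le> 1 then 1 else 0 :: complex)" for N
    using arg_cong[OF sqrt_coeff_convolution[of N], of complex_of_real] by (simp split: if_splits)
  then show ?thesis
    by (simp only: power_series_lmult[OF a(1) summable summable] power_series_one_plus)
qed

end

subsection \<open>Closed *-subalgebras and their states\<close>

locale closed_star_subalgebra = compact_dynamics +
  fixes B :: "'a elt set"
  assumes subset_l1: "B \<subseteq> l1space"
    and lone_mem: "lone \<in> B"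
    and ladd_mem: "a \<in> B \<Longrightarrow> b \<in> B \<Longrightarrow> ladd a b \<in> B"
    and lscale_mem: "a \<in> B \<Longrightarrow> lscale c a \<in> B"
    and lmult_mem: "a \<in> B \<Longrightarrow> b \<in> B \<Longrightarrow> a \<odot> b \<in> B"
    and lstar_mem: "a \<in> B \<Longrightarrow> adj a \<in> B"
    and series_mem:
      "(\<And>n::nat. u n \<in> B) \<Longrightarrow> (\<lambda>n. l1norm (u n)) summable_on UNIV \<Longrightarrow> series u \<in> B"
begin

lemma mem_l1: "a \<in> B \<Longrightarrow> a \<in> l1space"
  using subset_l1 by blast

lemma zero_mem: "(\<lambda>n x. 0) \<in> B"
  using lscale_mem[OF lone_mem, of 0] by (simp add: lscale_def)

lemma sum_mem:
  assumes "finite K" "\<And>j. j \<in> K \<Longrightarrow> u j \<in> B"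
  shows "(\<lambda>n x. \<Sum>j\<in>K. u j n x) \<in> B"
  using assms
proof (induction K rule: finite_induct)
  case (insert j K)
  then have "ladd (u j) (\<lambda>n x. \<Sum>i\<in>K. u i n x) \<in> B" by (simp add: ladd_mem)
  then show ?case using insert.hyps by (simp add: ladd_def)
qed (simp add: zero_mem)

lemma selfadjoint_sqrt:
  assumes a: "a \<in> B" "adj a = a" "l1norm a < 1"
  obtains b where "b \<in> B" "adj b = b" "b \<odot> b = ladd lone a"
proof
  let ?b = "power_series (\<lambda>n. of_real (sqrt_coeff n)) a"
  have l1: "a \<in> l1space" using a(1) by (rule mem_l1)
  have "lpow a n \<in> B" for n
    by (induction n) (simp_all add: lone_mem lmult_mem a(1))
  then show "?b \<in> B"
    unfolding power_series_def using l1 a(3)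
    by (intro series_mem power_series_summable sqrt_coeff_summable l1norm_nonneg lscale_mem)
  show "adj ?b = ?b" using lstar_power_series[OF l1] a(2) by simp
  show "?b \<odot> ?b = ladd lone a" by (rule power_series_sqrt_lmult_self[OF l1 a(3)])
qed

end

sublocale compact_dynamics \<subseteq> l1: closed_star_subalgebra \<sigma> l1space
  by unfold_locales (simp_all add: lone_l1 ladd_l1 lscale_l1 lmult_l1 lstar_l1 series_l1)

locale star_algebra_state = closed_star_subalgebra +
  fixes \<phi> :: "'a elt \<Rightarrow> complex"
  assumes state_ladd: "a \<in> B \<Longrightarrow> b \<in> B \<Longrightarrow> \<phi> (ladd a b) = \<phi> a + \<phi> b"
    and state_lscale: "a \<in> B \<Longrightarrow> \<phi> (lscale c a) = c * \<phi> a"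
    and state_square_nonneg: "a \<in> B \<Longrightarrow> nonneg (\<phi> (adj a \<odot> a))"
    and state_lone: "\<phi> lone = 1"
begin

lemma state_sum:
  assumes "finite K" "\<And>j. j \<in> K \<Longrightarrow> u j \<in> B"
  shows "\<phi> (\<lambda>n x. \<Sum>j\<in>K. u j n x) = (\<Sum>j\<in>K. \<phi> (u j))"
  using assms
proof (induction K rule: finite_induct)
  case empty
  show ?case using state_lscale[OF lone_mem, of 0] by (simp add: lscale_def)
next
  case (insert j K)
  then have "\<phi> (ladd (u j) (\<lambda>n x. \<Sum>i\<in>K. u i n x)) = \<phi> (u j) + (\<Sum>i\<in>K. \<phi> (u i))"
    by (simp add: state_ladd sum_mem)
  then show ?case using insert.hyps by (simp add: ladd_def)
qed

lemma state_square_ladd: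
  assumes "a \<in> B" "b \<in> B"
  shows "\<phi> (adj (ladd a (lscale t b)) \<odot> ladd a (lscale t b))
    = \<phi> (adj a \<odot> a) + t * \<phi> (adj a \<odot> b) + cnj t * \<phi> (adj b \<odot> a) + t * cnj t * \<phi> (adj b \<odot> b)"
  using assms
  by (simp add: lstar_ladd lstar_lscale lmult_ladd_left lmult_ladd_right lmult_lscale_left
      lmult_lscale_right state_ladd state_lscale ladd_mem lscale_mem lmult_mem lstar_mem mem_l1
      algebra_simps)

lemma state_quadratic_nonneg:
  assumes "a \<in> B" "b \<in> B"
  shows "nonneg (\<phi> (adj a \<odot> a) + t * \<phi> (adj a \<odot> b) + cnj t * \<phi> (adj b \<odot> a)
    + t * cnj t * \<phi> (adj b \<odot> b))"
  unfolding state_square_ladd[OF assms, symmetric]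
  by (intro state_square_nonneg ladd_mem lscale_mem assms)

lemma state_hermitian:
  assumes "a \<in> B" "b \<in> B"
  shows "\<phi> (adj b \<odot> a) = cnj (\<phi> (adj a \<odot> b))"
  using nonneg_quadratic_imp_hermitian[OF state_quadratic_nonneg state_square_nonneg] assms by blast

lemma state_lstar: "a \<in> B \<Longrightarrow> \<phi> (adj a) = cnj (\<phi> a)"
  using state_hermitian[OF lone_mem, of a] by (simp add: lmult_lone lone_lmult lstar_lone)

lemma state_Cauchy_Schwarz:
  assumes "a \<in> B" "b \<in> B"
  shows "(cmod (\<phi> (adj a \<odot> b)))\<^sup>2 \<le> Re (\<phi> (adj a \<odot> a)) * Re (\<phi> (adj b \<odot> b))"
  using nonneg_quadratic_discriminant[OF state_quadratic_nonneg state_square_nonneg] assms by blast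

lemma state_selfadjoint_le:
  assumes a: "a \<in> B" "adj a = a"
  shows "Re (\<phi> a) \<le> l1norm a"
proof (rule dense_ge)
  fix t assume t: "l1norm a < t"
  then have "0 < t" using l1norm_nonneg[OF mem_l1[OF a(1)]] by linarith
  let ?c = "lscale (of_real (- 1 / t)) a"
  have c: "?c \<in> B" "adj ?c = ?c" using a by (simp_all add: lscale_mem lstar_lscale)
  have "l1norm ?c \<le> cmod (of_real (- 1 / t)) * l1norm a"
    by (rule lscale_l1(2)[OF mem_l1[OF a(1)]])
  also have "\<dots> < 1" using t \<open>0 < t\<close> by (simp add: norm_divide)
  finally obtain b where b: "b \<in> B" "adj b = b" "b \<odot> b = ladd lone ?c"
    using selfadjoint_sqrt[OF c] by blast
  have "\<phi> (adj b \<odot> b) = 1 - of_real (1 / t) * \<phi> a"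
    using a(1) by (simp add: b state_ladd state_lscale state_lone lone_mem lscale_mem)
  then have "0 \<le> 1 - Re (\<phi> a) / t"
    using state_square_nonneg[OF b(1)] by (simp add: nonneg_def)
  with \<open>0 < t\<close> show "Re (\<phi> a) \<le> t" by (simp add: field_simps)
qed

lemma norm_state_le:
  assumes a: "a \<in> B"
  shows "cmod (\<phi> a) \<le> l1norm a"
proof (rule power2_le_imp_le)
  have l1: "a \<in> l1space" "adj a \<in> l1space" using a by (simp_all add: mem_l1 lstar_mem)
  have "(cmod (\<phi> a))\<^sup>2 \<le> Re (\<phi> (adj a \<odot> a))"
    using state_Cauchy_Schwarz[OF lone_mem a] by (simp add: lstar_lone lone_lmult state_lone)
  also have "\<dots> \<le> l1norm (adj a \<odot> a)"
    using a
    by (intro state_selfadjoint_le) (simp_all add: lmult_mem lstar_mem lstar_lmult lstar_lstar)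
  also have "\<dots> \<le> l1norm (adj a) * l1norm a" by (rule lmult_l1(2)[OF l1(2,1)])
  also have "\<dots> \<le> (l1norm a)\<^sup>2"
    unfolding power2_eq_square using l1 by (intro mult_right_mono lstar_l1(2) l1norm_nonneg)
  finally show "(cmod (\<phi> a))\<^sup>2 \<le> (l1norm a)\<^sup>2" .
  show "0 \<le> l1norm a" by (rule l1norm_nonneg[OF l1(1)])
qed

lemma state_multiplicative_right:
  assumes a: "a \<in> B" and b: "b \<in> B" and square: "\<phi> (adj b \<odot> b) = cnj (\<phi> b) * \<phi> b"
  shows "\<phi> (a \<odot> b) = \<phi> a * \<phi> b"
proof -
  let ?h = "ladd b (lscale (- \<phi> b) lone)"
  have h: "?h \<in> B" using b by (intro ladd_mem lscale_mem lone_mem)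
  have "\<phi> (adj ?h \<odot> ?h) = 0"
    unfolding state_square_ladd[OF b lone_mem]
    by (simp add: square lstar_lone lmult_lone lone_lmult state_lone state_lstar[OF b])
  then have "\<phi> (a \<odot> ?h) = 0"
    using state_Cauchy_Schwarz[OF lstar_mem[OF a] h] by (simp add: lstar_lstar)
  moreover have "a \<odot> ?h = ladd (a \<odot> b) (lscale (- \<phi> b) a)"
    using a b by (simp add: lmult_ladd_right lmult_lscale_right lmult_lone mem_l1 lone_l1 lscale_l1)
  ultimately show ?thesis
    using a b by (simp add: state_ladd state_lscale lmult_mem lscale_mem)
qed

lemma state_multiplicative_left:
  assumes a: "a \<in> B" and b: "b \<in> B" and square: "\<phi> (b \<odot> adj b) = \<phi> b * cnj (\<phi> b)"
  shows "\<phi> (b \<odot> a) = \<phi> b * \<phi> a"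
proof -
  have "\<phi> (b \<odot> a) = cnj (\<phi> (adj a \<odot> adj b))"
    using state_lstar[of "adj a \<odot> adj b"] a b
    by (simp add: lstar_lmult lstar_lstar lmult_mem lstar_mem)
  also have "\<phi> (adj a \<odot> adj b) = \<phi> (adj a) * \<phi> (adj b)"
    using a b square
    by (intro state_multiplicative_right lstar_mem) (simp_all add: lstar_lstar state_lstar)
  finally show ?thesis using a b by (simp add: state_lstar)
qed

end

subsection \<open>The positive cone\<close>

context compact_dynamics
begin

lemma poscone_cases:
  assumes "a \<in> poscone \<sigma>"
  obtains m :: nat and l where "\<And>j. j < m \<Longrightarrow> l j \<in> l1space"
    "a = (\<lambda>n x. \<Sum>j<m. (adj (l j) \<odot> l j) n x)"
  using assms by (auto simp: poscone_def)

lemma lstar_lmult_self_poscone: "a \<in> l1space \<Longrightarrow> adj a \<odot> a \<in> poscone \<sigma>"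
  unfolding poscone_def by (rule CollectI, rule exI[of _ "1::nat"], rule exI[of _ "\<lambda>_. a"]) auto

lemma poscone_l1:
  assumes "a \<in> poscone \<sigma>" shows "a \<in> l1space"
proof -
  obtain m :: nat and l where l: "\<And>j. j < m \<Longrightarrow> l j \<in> l1space"
    and a: "a = (\<lambda>n x. \<Sum>j<m. (adj (l j) \<odot> l j) n x)"
    by (rule poscone_cases[OF assms]) blast
  show ?thesis unfolding a by (rule l1.sum_mem) (use l in \<open>auto intro: lmult_l1 lstar_l1\<close>)
qed

lemma lstar_lmult_self_0:
  assumes "a \<in> l1space"
  shows "(adj a \<odot> a) 0 x = of_real (\<Sum>\<^sub>\<infinity>k. (cmod (a k (iterate k x)))\<^sup>2)"
proof -
  have "(adj a \<odot> a) 0 x = autocorrelation (\<lambda>k. a k (iterate k x)) 0"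
    by (simp add: autocorrelation_def lstar_lmult_self)
  also have "\<dots> = of_real (\<Sum>\<^sub>\<infinity>k. (cmod (a k (iterate k x)))\<^sup>2)"
    by (rule autocorrelation_0[OF l1_square_summable[OF assms]])
  finally show ?thesis .
qed

lemma poscone_eq_lzero:
  assumes "a \<in> poscone \<sigma>" and a0: "\<And>x. a 0 x = 0" shows "a = lzero"
proof -
  obtain m :: nat and l where l: "\<And>j. j < m \<Longrightarrow> l j \<in> l1space"
    and a: "a = (\<lambda>n x. \<Sum>j<m. (adj (l j) \<odot> l j) n x)"
    by (rule poscone_cases[OF assms(1)]) blast
  define S where "S j x = (\<Sum>\<^sub>\<infinity>k. (cmod (l j k (iterate k x)))\<^sup>2)" for j x
  have S_nonneg: "0 \<le> S j x" for j x unfolding S_def by (rule infsum_nonneg) simp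
  have "l j = lzero" if j: "j < m" for j
  proof (intro ext)
    fix k y
    define x where "x = iterate (- k) y"
    have "complex_of_real (\<Sum>j<m. S j x) = a 0 x"
      using l by (simp add: a lstar_lmult_self_0 S_def)
    then have "(\<Sum>j<m. S j x) = 0" using a0 by (metis of_real_eq_0_iff)
    then have "S j x = 0" using S_nonneg j by (simp add: sum_nonneg_eq_0_iff)
    then have "(cmod (l j k (iterate k x)))\<^sup>2 = 0"
      unfolding S_def using l1_square_summable[OF l[OF j]]
      by (intro nonneg_infsum_le_0D[where A = UNIV and f = "\<lambda>k. (cmod (l j k (iterate k x)))\<^sup>2"])
        auto
    then show "l j k y = lzero k y" by (simp add: x_def lzero_def)
  qed
  then have "(adj (l j) \<odot> l j) n x = 0" if "j < m" for j n x
    using that by (simp add: lmult_def lzero_def)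
  then show ?thesis by (simp add: a lzero_def)
qed

end

subsection \<open>The commutant\<close>

locale compact_hausdorff_dynamics = compact_dynamics \<sigma>
  for \<sigma> :: "'a::t2_space \<Rightarrow> 'a"
begin

lemma normal_space_UNIV: "normal_space (euclidean :: 'a topology)"
proof (rule compact_Hausdorff_or_regular_imp_normal_space)
  show "compact_space (euclidean :: 'a topology)"
    using compact_UNIV by (simp add: compact_space_def)
  have "Hausdorff_space (euclidean :: 'a topology)"
    unfolding Hausdorff_space_def disjnt_def using hausdorff by simp blast
  then show "Hausdorff_space (euclidean :: 'a topology) \<or> regular_space (euclidean :: 'a topology)" ..
qed

lemma bump_function:
  fixes x :: 'a
  assumes "open U" "x \<in> U"
  obtains f :: "'a \<Rightarrow> complex" where "contfun f" "f x = 1" "\<And>y. y \<notin> U \<Longrightarrow> f y = 0"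
proof -
  have "closedin euclidean (- U)" "closedin euclidean {x}" "disjnt (- U) {x}"
    using assms by (auto simp: disjnt_def closed_Compl)
  then obtain g :: "'a \<Rightarrow> real"
    where g: "continuous_map euclidean euclideanreal g" "g ` (- U) \<subseteq> {0}" "g ` {x} \<subseteq> {1}"
    using Urysohn_lemma_alt[OF normal_space_UNIV] by metis
  show thesis
  proof (rule that[of "\<lambda>y. of_real (g y)"])
    show "contfun (\<lambda>y. complex_of_real (g y))"
      using g(1) by (auto simp: contfun_def intro!: continuous_intros)
  qed (use g in auto)
qed

lemma support_subset_FixI:
  fixes g :: "'a \<Rightarrow> complex"
  assumes g: "contfun g"
    and intertwines: "\<And>f y. contfun f \<Longrightarrow> f y * g y = g y * f (iterate (- k) y)"
  shows "{y. g y \<noteq> 0} \<subseteq> FixI k"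
proof (rule interior_maximal)
  show "open {y. g y \<noteq> 0}"
    using g unfolding contfun_def by (intro open_Collect_neq continuous_intros)
  show "{y. g y \<noteq> 0} \<subseteq> Fix \<sigma> k"
  proof
    fix y assume "y \<in> {y. g y \<noteq> 0}"
    then have nonzero: "g y \<noteq> 0" by simp
    have "y \<in> Fix \<sigma> (- k)"
    proof (rule ccontr)
      assume "y \<notin> Fix \<sigma> (- k)"
      then have "y \<in> - {iterate (- k) y}" by (auto simp: mem_Fix)
      then obtain f :: "'a \<Rightarrow> complex" where "contfun f" "f y = 1" "f (iterate (- k) y) = 0"
        using bump_function[of "- {iterate (- k) y}" y] by auto
      with intertwines[of f y] nonzero show False by simp
    qed
    then show "y \<in> Fix \<sigma> k" by (simp add: Fix_minus)
  qed
qed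

lemma comm1_iff: "a \<in> comm1 \<sigma> \<longleftrightarrow> a \<in> l1space \<and> (\<forall>k x. a k x \<noteq> 0 \<longrightarrow> x \<in> FixI k)"
proof (intro iffI conjI)
  assume a: "a \<in> comm1 \<sigma>"
  then show l1: "a \<in> l1space" by (simp add: comm1_def)
  have "f y * a k y = a k y * f (iterate (- k) y)" if "contfun f" for f k y
  proof -
    have "emb f \<odot> a = a \<odot> emb f" using a that by (simp add: comm1_def)
    then have "(emb f \<odot> a) k y = (a \<odot> emb f) k y" by simp
    then show ?thesis by (simp only: emb_lmult lmult_emb)
  qed
  then show "\<forall>k x. a k x \<noteq> 0 \<longrightarrow> x \<in> FixI k"
    using support_subset_FixI[OF l1_contfun[OF l1]] by blast
next
  assume a: "a \<in> l1space \<and> (\<forall>k x. a k x \<noteq> 0 \<longrightarrow> x \<in> FixI k)"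
  have "emb f \<odot> a = a \<odot> emb f" for f
  proof (intro ext)
    fix k x
    show "(emb f \<odot> a) k x = (a \<odot> emb f) k x"
    proof (cases "a k x = 0")
      case False
      with a have "x \<in> FixI (- k)" by (simp add: FixI_minus)
      then show ?thesis by (simp add: emb_lmult lmult_emb FixI_imp_fixed)
    qed (simp add: emb_lmult lmult_emb)
  qed
  with a show "a \<in> comm1 \<sigma>" by (simp add: comm1_def)
qed

lemma comm1_support: "a \<in> comm1 \<sigma> \<Longrightarrow> a k x \<noteq> 0 \<Longrightarrow> x \<in> FixI k"
  by (simp add: comm1_iff)

lemma comm1_l1: "a \<in> comm1 \<sigma> \<Longrightarrow> a \<in> l1space"
  by (simp add: comm1_def)

lemma comm00_eq: "comm00 \<sigma> = c00space \<inter> comm1 \<sigma>"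
  by (auto simp: comm00_def comm1_def c00space_def)

lemma condexp_comm1_eq: "b \<in> comm1 \<sigma> \<Longrightarrow> condexp b = b"
  by (simp add: comm1_iff condexp_eq_self_iff)

lemma comm1_emb: "contfun f \<Longrightarrow> emb f \<in> comm1 \<sigma>"
  using FixI_0 by (auto simp: comm1_iff emb_l1) (auto simp: emb_def split: if_splits)

lemma comm1_lmult:
  assumes a: "a \<in> comm1 \<sigma>" and b: "b \<in> comm1 \<sigma>" shows "a \<odot> b \<in> comm1 \<sigma>"
  unfolding comm1_iff
proof (intro conjI allI impI)
  show "a \<odot> b \<in> l1space" using a b by (simp add: comm1_l1 lmult_l1)
  fix n x assume "(a \<odot> b) n x \<noteq> 0"
  then obtain k where "a k x * b (n - k) (iterate (- k) x) \<noteq> 0"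
    unfolding lmult_def by (metis (mono_tags, lifting) infsum_0)
  then have "x \<in> FixI k" "iterate (- k) x \<in> FixI (n - k)"
    using comm1_support a b by auto
  then show "x \<in> FixI n" by (simp add: FixI_sigpow FixI_diff_iff)
qed

lemma comm1_lstar:
  assumes a: "a \<in> comm1 \<sigma>" shows "adj a \<in> comm1 \<sigma>"
  unfolding comm1_iff
proof (intro conjI allI impI)
  show "adj a \<in> l1space" using a by (simp add: comm1_l1 lstar_l1)
  fix n x assume "adj a n x \<noteq> 0"
  then have "iterate (- n) x \<in> FixI (- n)" using comm1_support[OF a] by (simp add: lstar_apply)
  then show "x \<in> FixI n" by (simp add: FixI_sigpow FixI_minus)
qed

lemma comm1_series:
  assumes u: "\<And>i. u i \<in> comm1 \<sigma>" "(\<lambda>i. l1norm (u i)) summable_on UNIV"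
  shows "series u \<in> comm1 \<sigma>"
  unfolding comm1_iff
proof (intro conjI allI impI)
  show "series u \<in> l1space" using u by (intro series_l1 comm1_l1)
  fix k x assume "series u k x \<noteq> 0"
  then obtain i where "u i k x \<noteq> 0"
    unfolding series_def by (metis (mono_tags, lifting) infsum_0)
  then show "x \<in> FixI k" by (rule comm1_support[OF u(1)])
qed

sublocale commutant: closed_star_subalgebra \<sigma> "comm1 \<sigma>"
proof unfold_locales
  show "lone \<in> comm1 \<sigma>" by (simp add: lone_def comm1_emb contfun_const)
  show "ladd a b \<in> comm1 \<sigma>" if "a \<in> comm1 \<sigma>" "b \<in> comm1 \<sigma>" for a b
    using that unfolding comm1_iff by (simp add: ladd_l1) (metis ladd_def add_0)
  show "lscale c a \<in> comm1 \<sigma>" if "a \<in> comm1 \<sigma>" for a c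
    using that by (auto simp: comm1_iff lscale_l1) (auto simp: lscale_def)
qed (auto intro: comm1_l1 comm1_lmult comm1_lstar comm1_series)

lemma is_state_iff: "is_state \<sigma> \<phi> \<longleftrightarrow> star_algebra_state \<sigma> (comm1 \<sigma>) \<phi>"
  using commutant.closed_star_subalgebra_axioms
  by (auto simp: is_state_def star_algebra_state_def star_algebra_state_axioms_def)

lemma comm1_lstar_lmult_self:
  assumes a: "a \<in> comm1 \<sigma>"
  shows "(adj a \<odot> a) n x = autocorrelation (\<lambda>k. a k x) n"
proof -
  have "cnj (a k (iterate k x)) * a (n + k) (iterate k x) = cnj (a k x) * a (n + k) x" for k
  proof (cases "x \<in> FixI k")
    case False
    then have "a k x = 0" "a k (iterate k x) = 0"
      using comm1_support[OF a] FixI_sigpow by blast+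
    then show ?thesis by simp
  qed (simp add: FixI_imp_fixed)
  then show ?thesis by (simp add: lstar_lmult_self autocorrelation_def)
qed

lemma condexp_lmult_left:
  assumes a: "a \<in> comm1 \<sigma>" shows "condexp (a \<odot> l) = a \<odot> condexp l"
proof (intro ext)
  fix n x
  have "indicator (FixI n) x * (a k x * l (n - k) (iterate (- k) x))
      = a k x * (indicator (FixI (n - k)) (iterate (- k) x) * l (n - k) (iterate (- k) x))" for k
  proof (cases "a k x = 0")
    case False
    then have "x \<in> FixI k" by (rule comm1_support[OF a])
    then show ?thesis by (simp add: indicator_def FixI_sigpow FixI_diff_iff)
  qed simp
  then show "condexp (a \<odot> l) n x = (a \<odot> condexp l) n x"
    by (simp only: condexp_def lmult_def flip: infsum_cmult_right')
qed

lemma condexp_lmult_right: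
  assumes b: "b \<in> comm1 \<sigma>" shows "condexp (l \<odot> b) = condexp l \<odot> b"
proof -
  have "condexp (l \<odot> b) = condexp (adj (adj b \<odot> adj l))"
    by (simp only: lstar_lmult lstar_lstar)
  also have "\<dots> = adj (adj b \<odot> condexp (adj l))"
    by (simp only: condexp_lstar[of "_ \<odot> _"] condexp_lmult_left[OF comm1_lstar[OF b]])
  also have "\<dots> = condexp l \<odot> b"
    by (simp only: condexp_lstar lstar_lmult lstar_lstar)
  finally show ?thesis .
qed

end

subsection \<open>States at a point\<close>

context compact_hausdorff_dynamics
begin

definition point_state :: "'a \<Rightarrow> int \<Rightarrow> complex \<Rightarrow> 'a elt \<Rightarrow> complex" where
  "point_state x n w a = a 0 x + (cnj w * a n x + w * a (- n) x) / 2"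

lemma point_state_square_nonneg:
  assumes w: "cmod w \<le> 1" and a: "a \<in> comm1 \<sigma>"
  shows "nonneg (point_state x n w (adj a \<odot> a))"
proof -
  define S where "S = (\<Sum>\<^sub>\<infinity>k. (cmod (a k x))\<^sup>2)"
  let ?T = "autocorrelation (\<lambda>k. a k x)"
  note summable = l1_square_summable[OF comm1_l1[OF a], of "\<lambda>_. x"]
  have "point_state x n w (adj a \<odot> a) = ?T 0 + (cnj w * ?T n + w * ?T (- n)) / 2"
    by (simp add: point_state_def comm1_lstar_lmult_self[OF a])
  also have "\<dots> = of_real S + (cnj w * ?T n + cnj (cnj w * ?T n)) / 2"
    by (simp add: autocorrelation_0[OF summable] autocorrelation_uminus S_def)
  also have "\<dots> = of_real (S + Re (cnj w * ?T n))"
    by (subst complex_add_cnj) simp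
  finally have eq: "point_state x n w (adj a \<odot> a) = of_real (S + Re (cnj w * ?T n))" .
  have "cmod (cnj w * ?T n) \<le> 1 * S"
    unfolding norm_mult S_def using w norm_autocorrelation_le[OF summable] by (intro mult_mono) auto
  then have "0 \<le> S + Re (cnj w * ?T n)" using abs_Re_le_cmod[of "cnj w * ?T n"] by linarith
  then show ?thesis by (simp add: eq nonneg_def)
qed

lemma is_state_point_state:
  assumes "n \<noteq> 0" "cmod w \<le> 1"
  shows "is_state \<sigma> (point_state x n w)"
  using assms point_state_square_nonneg
  by (auto simp: is_state_def)
    (simp_all add: point_state_def ladd_def lscale_def lone_def emb_def algebra_simps
      add_divide_distrib)

lemma coefficient_eq_point_states:
  "a n x = point_state x n 1 a + \<i> * point_state x n \<i> a - (1 + \<i>) * point_state x n 0 a"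
  by (simp add: point_state_def field_simps)

lemma coefficient_0_eq_point_state: "a 0 x = point_state x n 0 a"
  by (simp add: point_state_def)

lemma coefficient_eqI_point_states:
  assumes "\<And>m w. m \<noteq> 0 \<Longrightarrow> cmod w \<le> 1 \<Longrightarrow> point_state x m w a = c * point_state x m w b"
  shows "a n x = c * b n x"
proof (cases "n = 0")
  case True
  then show ?thesis using assms[of 1 0] by (simp flip: coefficient_0_eq_point_state)
next
  case False
  then show ?thesis
    unfolding coefficient_eq_point_states[of a n x] coefficient_eq_point_states[of b n x]
    by (simp add: assms algebra_simps)
qed

lemma norm_coefficient_le_point_states:
  assumes bound: "\<And>m w. m \<noteq> 0 \<Longrightarrow> cmod w \<le> 1 \<Longrightarrow> cmod (point_state x m w a) \<le> C"
  shows "cmod (a n x) \<le> 4 * C"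
proof (cases "n = 0")
  case True
  have "cmod (a 0 x) \<le> C" using bound[of 1 0] by (simp flip: coefficient_0_eq_point_state)
  moreover from this have "0 \<le> C" using norm_ge_zero order_trans by blast
  ultimately show ?thesis using True by simp
next
  case False
  have "cmod (a n x) \<le> cmod (point_state x n 1 a) + cmod (\<i> * point_state x n \<i> a)
      + cmod ((1 + \<i>) * point_state x n 0 a)"
    unfolding coefficient_eq_point_states[of a n x]
    by (intro norm_triangle_le_diff add_mono norm_triangle_ineq order_refl)
  also have "\<dots> \<le> C + 1 * C + 2 * C"
    unfolding norm_mult using bound[OF False] norm_triangle_ineq[of 1 \<i>]
    by (intro add_mono mult_mono) auto
  finally show ?thesis by simp
qed

end

subsection \<open>Existence of the projection\<close>

locale clopen_dynamics = compact_hausdorff_dynamics +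
  assumes closed_FixI: "closed (FixI k)"
begin

lemma condexp_comm1:
  assumes a: "a \<in> l1space"
  shows "condexp a \<in> comm1 \<sigma>" "l1norm (condexp a) \<le> l1norm a"
proof -
  have "condexp a k = (\<lambda>x. if x \<in> FixI k then a k x else 0)" for k
    by (auto simp: condexp_def indicator_def)
  then have cont: "contfun (condexp a k)" for k
    using contfun_clopen[OF l1_contfun[OF a] open_interior closed_FixI] by simp
  have bound: "cmod (condexp a k x) \<le> supnorm (a k)" for k x
    using l1_cmod_le[OF a] l1_supnorm_nonneg[OF a] by (simp add: condexp_def indicator_def)
  note dominated = l1_dominated[OF cont bound l1norm_has_sum[OF a]]
  then show "condexp a \<in> comm1 \<sigma>"
    by (simp add: comm1_iff condexp_eq_self_iff[symmetric] condexp_condexp)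
  show "l1norm (condexp a) \<le> l1norm a" by (rule dominated(2))
qed

text \<open>At \<open>x\<close>, the \<open>n\<close> with \<open>x \<in> FixI n\<close> form a subgroup of the integers; \<open>least_rep K j\<close> is the set
  of \<open>x\<close> for which \<open>j\<close> is the least element of \<open>K\<close> in its coset.\<close>

definition least_rep :: "int set \<Rightarrow> int \<Rightarrow> 'a set" where
  "least_rep K j = {x. \<forall>i\<in>K. i < j \<longrightarrow> x \<notin> FixI (j - i)}"

lemma least_rep_clopen:
  assumes "finite K" shows "open (least_rep K j)" "closed (least_rep K j)"
proof -
  have eq: "least_rep K j = (\<Inter>i\<in>{i\<in>K. i < j}. - FixI (j - i))"
    by (auto simp: least_rep_def)
  show "open (least_rep K j)" unfolding eq using assms closed_FixI by (intro open_INT) auto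
  show "closed (least_rep K j)" unfolding eq by (intro closed_INT) auto
qed

lemma least_rep_exists:
  assumes K: "finite K" "k \<in> K"
  shows "\<exists>j\<in>K. x \<in> least_rep K j \<and> x \<in> FixI (k - j)"
proof -
  let ?coset = "{i\<in>K. x \<in> FixI (k - i)}"
  have finite: "finite ?coset" and "?coset \<noteq> {}" using K FixI_0 by auto
  then have j: "Min ?coset \<in> K" "x \<in> FixI (k - Min ?coset)" using Min_in by auto
  have "x \<in> least_rep K (Min ?coset)"
    unfolding least_rep_def
  proof (intro CollectI ballI impI notI)
    fix i assume i: "i \<in> K" "i < Min ?coset" "x \<in> FixI (Min ?coset - i)"
    then have "x \<in> FixI (k - i)" using FixI_add[OF j(2) i(3)] by simp
    then have "Min ?coset \<le> i" using i(1) finite by (intro Min_le) auto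
    with i(2) show False by simp
  qed
  with j show ?thesis by blast
qed

lemma least_rep_unique:
  assumes i: "i \<in> K" "x \<in> least_rep K i" "x \<in> FixI (k - i)"
    and j: "j \<in> K" "x \<in> least_rep K j" "x \<in> FixI (k - j)"
  shows "i = j"
proof -
  have "x \<in> FixI (j - i)" "x \<in> FixI (i - j)"
    using FixI_diff[OF i(3) j(3)] FixI_diff[OF j(3) i(3)] by simp_all
  with i(1,2) j(1,2) show ?thesis by (cases i j rule: linorder_cases) (auto simp: least_rep_def)
qed

lemma sum_least_rep:
  assumes K: "finite K" "k \<in> K"
  shows "(\<Sum>j\<in>K. if x \<in> least_rep K j \<and> x \<in> FixI (k - j) then c else 0) = (c :: complex)"
proof -
  obtain i where i: "i \<in> K" "x \<in> least_rep K i" "x \<in> FixI (k - i)"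
    using least_rep_exists[OF K] by blast
  have "x \<in> least_rep K j \<and> x \<in> FixI (k - j) \<longleftrightarrow> j = i" if "j \<in> K" for j
    using i least_rep_unique[OF that _ _ i] by blast
  then have "(\<Sum>j\<in>K. if x \<in> least_rep K j \<and> x \<in> FixI (k - j) then c else 0)
      = (\<Sum>j\<in>K. if j = i then c else 0)"
    by (intro sum.cong) simp_all
  then show ?thesis using i(1) K by simp
qed

definition coset_part :: "int set \<Rightarrow> 'a elt \<Rightarrow> int \<Rightarrow> 'a elt" where
  "coset_part K l j = (\<lambda>n x. if x \<in> least_rep K j \<inter> FixI n then l (n + j) (iterate j x) else 0)"

lemma coset_part_comm1:
  assumes K: "finite K" and l: "l \<in> l1space" shows "coset_part K l j \<in> comm1 \<sigma>"
  unfolding comm1_iff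
proof (intro conjI allI impI)
  have cont: "contfun (coset_part K l j n)" for n
    unfolding coset_part_def
    using least_rep_clopen[OF K] closed_FixI
    by (intro contfun_clopen contfun_sigpow l1_contfun l) auto
  have bound: "cmod (coset_part K l j n x) \<le> supnorm (l (n + j))" for n x
    using l1_cmod_le[OF l] l1_supnorm_nonneg[OF l] by (simp add: coset_part_def)
  have "((\<lambda>n. supnorm (l (n + j))) has_sum l1norm l) UNIV"
    using l1norm_has_sum[OF l]
    by (simp only: has_sum_reindex_bij_betw[OF bij_plus_right, of "\<lambda>k. supnorm (l k)"])
  then show "coset_part K l j \<in> l1space" by (rule l1_dominated(1)[OF cont bound])
qed (auto simp: coset_part_def split: if_splits)

lemma coset_part_square:
  assumes K: "finite K" and l: "l \<in> l1space" and supp: "{k. l k \<noteq> (\<lambda>x. 0)} \<subseteq> K"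
  shows "(adj (coset_part K l j) \<odot> coset_part K l j) m x
    = (\<Sum>k\<in>K. if x \<in> least_rep K j \<and> x \<in> FixI (k - j)
        then indicator (FixI m) x * (cnj (l k (iterate k x)) * l (m + k) (iterate k x)) else 0)"
    (is "_ = (\<Sum>k\<in>K. ?term k)")
proof -
  let ?b = "coset_part K l j"
  have l_zero: "l k x = 0" if "k \<notin> K" for k x
    using supp that by (metis (mono_tags, lifting) mem_Collect_eq subsetD)
  have translate: "cnj (?b (k - j) x) * ?b (m + (k - j)) x = ?term k" for k
  proof (cases "x \<in> FixI (k - j)")
    case True
    have "iterate k x = iterate j x"
      using FixI_imp_fixed[OF True] sigpow_add[of j "k - j" x] by simp
    moreover have "x \<in> FixI (m + (k - j)) \<longleftrightarrow> x \<in> FixI m"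
      using FixI_diff_iff[OF True, of "m + (k - j)"] by simp
    ultimately show ?thesis using True by (simp add: coset_part_def)
  qed (simp add: coset_part_def)
  have "(adj ?b \<odot> ?b) m x = (\<Sum>\<^sub>\<infinity>k. cnj (?b k x) * ?b (m + k) x)"
    unfolding comm1_lstar_lmult_self[OF coset_part_comm1[OF K l]] autocorrelation_def ..
  also have "\<dots> = (\<Sum>\<^sub>\<infinity>k. cnj (?b (k - j) x) * ?b (m + (k - j)) x)"
    by (rule infsum_reindex_bij_betw[OF bij_diff_right, symmetric])
  also have "\<dots> = (\<Sum>\<^sub>\<infinity>k\<in>K. ?term k)"
    unfolding translate by (rule infsum_cong_neutral) (auto simp: l_zero)
  finally show ?thesis using K by simp
qed

lemma condexp_square_finite:
  assumes K: "finite K" and l: "l \<in> l1space" and supp: "{k. l k \<noteq> (\<lambda>x. 0)} \<subseteq> K"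
  shows "condexp (adj l \<odot> l) = (\<lambda>m x. \<Sum>j\<in>K. (adj (coset_part K l j) \<odot> coset_part K l j) m x)"
proof (intro ext)
  fix m x
  have l_zero: "l k x = 0" if "k \<notin> K" for k x
    using supp that by (metis (mono_tags, lifting) mem_Collect_eq subsetD)
  let ?c = "\<lambda>k. indicator (FixI m) x * (cnj (l k (iterate k x)) * l (m + k) (iterate k x))"
  have "(\<Sum>j\<in>K. (adj (coset_part K l j) \<odot> coset_part K l j) m x)
      = (\<Sum>k\<in>K. \<Sum>j\<in>K. if x \<in> least_rep K j \<and> x \<in> FixI (k - j) then ?c k else 0)"
    unfolding coset_part_square[OF assms] by (rule sum.swap)
  also have "\<dots> = (\<Sum>k\<in>K. ?c k)"
    using sum_least_rep[OF K] by (intro sum.cong) simp_all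
  also have "\<dots> = (\<Sum>\<^sub>\<infinity>k\<in>K. ?c k)" using K by simp
  also have "\<dots> = (\<Sum>\<^sub>\<infinity>k. ?c k)"
    by (rule infsum_cong_neutral) (auto simp: l_zero)
  also have "\<dots> = condexp (adj l \<odot> l) m x"
    by (simp only: condexp_def lstar_lmult_self infsum_cmult_right')
  finally show "condexp (adj l \<odot> l) m x
      = (\<Sum>j\<in>K. (adj (coset_part K l j) \<odot> coset_part K l j) m x)" ..
qed

lemma state_condexp_square_finite_nonneg:
  assumes \<phi>: "is_state \<sigma> \<phi>" and K: "finite K" and l: "l \<in> l1space"
    and supp: "{k. l k \<noteq> (\<lambda>x. 0)} \<subseteq> K"
  shows "nonneg (\<phi> (condexp (adj l \<odot> l)))"
proof -
  interpret star_algebra_state \<sigma> "comm1 \<sigma>" \<phi> using \<phi> by (simp add: is_state_iff)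
  have "\<phi> (condexp (adj l \<odot> l)) = (\<Sum>j\<in>K. \<phi> (adj (coset_part K l j) \<odot> coset_part K l j))"
    unfolding condexp_square_finite[OF K l supp]
    by (intro state_sum comm1_lmult comm1_lstar coset_part_comm1 K l)
  then show ?thesis
    using coset_part_comm1[OF K l] by (auto intro!: nonneg_sum state_square_nonneg)
qed

lemma state_condexp_square_nonneg:
  assumes \<phi>: "is_state \<sigma> \<phi>" and l: "l \<in> l1space"
  shows "nonneg (\<phi> (condexp (adj l \<odot> l)))"
proof -
  interpret star_algebra_state \<sigma> "comm1 \<sigma>" \<phi> using \<phi> by (simp add: is_state_iff)
  let ?z = "\<phi> (condexp (adj l \<odot> l))"
  have "\<exists>w\<in>{w. nonneg w}. dist w ?z < e" if e: "0 < e" for e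
  proof -
    define \<delta> where "\<delta> = e / (2 * l1norm l + 1)"
    have norm_nonneg: "0 \<le> l1norm l" by (rule l1norm_nonneg[OF l])
    then have \<delta>: "0 < \<delta>" "\<delta> * (2 * l1norm l) < e" using e by (simp_all add: \<delta>_def field_simps)
    obtain K where K: "finite K" "l1norm (restr (- K) l) \<le> \<delta>"
      using restr_tail_small[OF l \<delta>(1)] .
    let ?p = "restr K l" and ?r = "restr (- K) l"
    obtain y where y: "y \<in> l1space" "adj l \<odot> l = ladd (adj ?p \<odot> ?p) y"
      and norm_y: "l1norm y \<le> l1norm ?r * (l1norm ?p + l1norm l)"
      using lstar_lmult_self_ladd[OF restr_l1(1)[OF l] restr_l1(1)[OF l], of K "- K"]
      unfolding restr_split by blast
    have "?z = \<phi> (condexp (adj ?p \<odot> ?p)) + \<phi> (condexp y)"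
      using y l
      by (simp add: condexp_ladd state_ladd condexp_comm1(1) lmult_l1(1) lstar_l1(1) restr_l1(1))
    moreover have "cmod (\<phi> (condexp y)) \<le> l1norm y"
      using norm_state_le condexp_comm1 y(1) order_trans by blast
    moreover have "l1norm y \<le> \<delta> * (2 * l1norm l)"
      using norm_y mult_mono[OF K(2), of "l1norm ?p + l1norm l" "2 * l1norm l"] restr_l1[OF l]
        \<delta>(1) norm_nonneg l1norm_nonneg by force
    ultimately have "dist (\<phi> (condexp (adj ?p \<odot> ?p))) ?z < e"
      using \<delta>(2) by (simp add: dist_norm)
    moreover have "nonneg (\<phi> (condexp (adj ?p \<odot> ?p)))"
      by (rule state_condexp_square_finite_nonneg[OF \<phi> K(1) restr_l1(1)[OF l]])
        (auto simp: restr_def)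
    ultimately show ?thesis by blast
  qed
  then show ?thesis using closed_approachable[OF closed_nonneg] by blast
qed

lemma state_condexp_poscone_nonneg:
  assumes a: "a \<in> poscone \<sigma>" and \<phi>: "is_state \<sigma> \<phi>"
  shows "nonneg (\<phi> (condexp a))"
proof -
  interpret star_algebra_state \<sigma> "comm1 \<sigma>" \<phi> using \<phi> by (simp add: is_state_iff)
  obtain m :: nat and l where l: "\<And>j. j < m \<Longrightarrow> l j \<in> l1space"
    and eq: "a = (\<lambda>n x. \<Sum>j<m. (adj (l j) \<odot> l j) n x)"
    by (rule poscone_cases[OF a]) blast
  have "condexp a = (\<lambda>n x. \<Sum>j<m. condexp (adj (l j) \<odot> l j) n x)"
    by (simp add: eq condexp_def sum_distrib_left)
  moreover have "condexp (adj (l j) \<odot> l j) \<in> comm1 \<sigma>" if "j < m" for j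
    using l[OF that] by (intro condexp_comm1 lmult_l1 lstar_l1)
  ultimately have "\<phi> (condexp a) = (\<Sum>j<m. \<phi> (condexp (adj (l j) \<odot> l j)))"
    using state_sum[of "{..<m}" "\<lambda>j. condexp (adj (l j) \<odot> l j)"] by simp
  then show ?thesis
    using l by (auto intro!: nonneg_sum state_condexp_square_nonneg[OF \<phi>])
qed

lemma is_pos_proj_condexp: "is_pos_proj \<sigma> condexp"
  unfolding is_pos_proj_def is_proj_def
proof (intro conjI ballI allI impI)
  show "condexp ` l1space = comm1 \<sigma>"
  proof (intro equalityI subsetI)
    show "b \<in> condexp ` l1space" if "b \<in> comm1 \<sigma>" for b
      using that by (intro image_eqI[of _ _ b]) (simp_all add: condexp_comm1_eq comm1_l1)
  qed (auto simp: condexp_comm1)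
qed (simp_all add: condexp_ladd condexp_lscale condexp_condexp state_condexp_poscone_nonneg)

end

subsection \<open>Positive projections\<close>

locale positive_projection = compact_hausdorff_dynamics +
  fixes E :: "'a elt \<Rightarrow> 'a elt"
  assumes pos_proj: "is_pos_proj \<sigma> E"
begin

lemma E_comm1: "a \<in> l1space \<Longrightarrow> E a \<in> comm1 \<sigma>"
  using pos_proj by (auto simp: is_pos_proj_def is_proj_def)

lemma E_fixes_comm1: "b \<in> comm1 \<sigma> \<Longrightarrow> E b = b"
  using pos_proj unfolding is_pos_proj_def is_proj_def by (metis imageE)

lemma E_ladd: "a \<in> l1space \<Longrightarrow> b \<in> l1space \<Longrightarrow> E (ladd a b) = ladd (E a) (E b)"
  using pos_proj by (simp add: is_pos_proj_def is_proj_def)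

lemma E_lscale: "a \<in> l1space \<Longrightarrow> E (lscale c a) = lscale c (E a)"
  using pos_proj by (simp add: is_pos_proj_def is_proj_def)

lemma state_comp_E:
  assumes "is_state \<sigma> \<phi>"
  shows "star_algebra_state \<sigma> l1space (\<lambda>a. \<phi> (E a))"
proof -
  interpret \<phi>: star_algebra_state \<sigma> "comm1 \<sigma>" \<phi> using assms by (simp add: is_state_iff)
  show ?thesis
  proof
    show "\<phi> (E (ladd a b)) = \<phi> (E a) + \<phi> (E b)" if "a \<in> l1space" "b \<in> l1space" for a b
      using that by (simp add: E_ladd \<phi>.state_ladd E_comm1)
    show "\<phi> (E (lscale c a)) = c * \<phi> (E a)" if "a \<in> l1space" for a c
      using that by (simp add: E_lscale \<phi>.state_lscale E_comm1)
    show "nonneg (\<phi> (E (adj a \<odot> a)))" if "a \<in> l1space" for a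
      using lstar_lmult_self_poscone[OF that] pos_proj assms by (simp add: is_pos_proj_def)
    show "\<phi> (E lone) = 1"
      by (simp add: E_fixes_comm1 commutant.lone_mem \<phi>.state_lone)
  qed
qed

lemma E_coefficient_bound:
  assumes a: "a \<in> l1space" shows "cmod (E a n x) \<le> 4 * l1norm a"
proof (rule norm_coefficient_le_point_states)
  fix m :: int and w :: complex
  assume "m \<noteq> 0" "cmod w \<le> 1"
  then interpret star_algebra_state \<sigma> l1space "\<lambda>a. point_state x m w (E a)"
    by (intro state_comp_E is_state_point_state)
  show "cmod (point_state x m w (E a)) \<le> l1norm a" by (rule norm_state_le[OF a])
qed

lemma point_state_E_emb:
  assumes "m \<noteq> 0" "contfun f" shows "point_state x m w (E (emb f)) = f x"
  using assms by (simp add: E_fixes_comm1 comm1_emb point_state_def) (simp add: emb_def)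

lemma point_state_E_module:
  assumes m: "m \<noteq> 0" and w: "cmod w \<le> 1" and f: "contfun f" and a: "a \<in> l1space"
  shows "point_state x m w (E (emb f \<odot> a)) = f x * point_state x m w (E a)"
    and "point_state x m w (E (a \<odot> emb f)) = f x * point_state x m w (E a)"
proof -
  interpret star_algebra_state \<sigma> l1space "\<lambda>a. point_state x m w (E a)"
    by (intro state_comp_E is_state_point_state m w)
  have "contfun (\<lambda>y. f y * cnj (f y))"
    using f by (auto simp: contfun_def intro!: continuous_intros)
  then have square: "point_state x m w (E (emb (\<lambda>y. f y * cnj (f y)))) = f x * cnj (f x)"
    by (rule point_state_E_emb[OF m])
  have "point_state x m w (E (emb f \<odot> a)) = point_state x m w (E (emb f)) * point_state x m w (E a)"
    by (intro state_multiplicative_left a emb_l1 f)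
      (simp add: lstar_emb emb_lmult_emb square point_state_E_emb[OF m f])
  then show "point_state x m w (E (emb f \<odot> a)) = f x * point_state x m w (E a)"
    by (simp add: point_state_E_emb[OF m f])
  have "point_state x m w (E (a \<odot> emb f)) = point_state x m w (E a) * point_state x m w (E (emb f))"
    by (intro state_multiplicative_right a emb_l1 f)
      (simp add: lstar_emb emb_lmult_emb square point_state_E_emb[OF m f] mult.commute[of "cnj _"])
  then show "point_state x m w (E (a \<odot> emb f)) = f x * point_state x m w (E a)"
    by (simp add: point_state_E_emb[OF m f])
qed

lemma E_emb_lmult:
  "contfun f \<Longrightarrow> a \<in> l1space \<Longrightarrow> E (emb f \<odot> a) n x = f x * E a n x"
  by (rule coefficient_eqI_point_states) (rule point_state_E_module)

lemma E_lmult_emb: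
  "contfun f \<Longrightarrow> a \<in> l1space \<Longrightarrow> E (a \<odot> emb f) n x = f x * E a n x"
  by (rule coefficient_eqI_point_states) (rule point_state_E_module)

lemma E_single_on_FixI:
  assumes g: "contfun g" and x: "x \<in> FixI k"
  shows "E (single k g) n x = single k g n x"
proof -
  obtain h where h: "contfun h" "h x = 1" "\<And>y. y \<notin> FixI k \<Longrightarrow> h y = 0"
    using bump_function[of "FixI k" x] x by auto
  have "emb h \<odot> single k g \<in> comm1 \<sigma>"
    unfolding comm1_iff
  proof (intro conjI allI impI)
    show "emb h \<odot> single k g \<in> l1space" by (intro lmult_l1 emb_l1 single_l1 h g)
    fix j y assume "(emb h \<odot> single k g) j y \<noteq> 0"
    then have "h y \<noteq> 0" "j = k" by (auto simp: emb_lmult single_def split: if_splits)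
    then show "y \<in> FixI j" using h(3) by blast
  qed
  then have "E (emb h \<odot> single k g) n x = (emb h \<odot> single k g) n x"
    by (simp add: E_fixes_comm1)
  then show ?thesis
    using E_emb_lmult[OF h(1) single_l1(1)[OF g]] by (simp add: emb_lmult h(2))
qed

lemma E_single_off_FixI:
  assumes g: "contfun g" and x: "x \<notin> FixI k"
  shows "E (single k g) n x = 0"
proof -
  note l1 = single_l1(1)[OF g, of k]
  have "contfun (E (single k g) n)" using E_comm1[OF l1] by (simp add: comm1_l1 l1_contfun)
  moreover have "f y * E (single k g) n y = E (single k g) n y * f (iterate (- k) y)"
    if f: "contfun f" for f y
  proof -
    have "single k g \<odot> emb f = emb (\<lambda>y. f (iterate (- k) y)) \<odot> single k g"
      by (intro ext) (simp add: lmult_emb emb_lmult single_def)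
    then show ?thesis
      using E_lmult_emb[OF f l1, of n y] E_emb_lmult[OF contfun_sigpow[OF f] l1, of "- k" n y]
      by auto
  qed
  ultimately have "{y. E (single k g) n y \<noteq> 0} \<subseteq> FixI k" by (rule support_subset_FixI)
  with x show ?thesis by blast
qed

lemma E_single:
  assumes g: "contfun g" shows "E (single k g) = condexp (single k g)"
proof (intro ext)
  fix n x
  have "single k g n x = 0" if "n \<noteq> k" using that by (simp add: single_def)
  then show "E (single k g) n x = condexp (single k g) n x"
    by (cases "x \<in> FixI k"; cases "n = k")
      (simp_all add: E_single_on_FixI[OF g] E_single_off_FixI[OF g] condexp_def)
qed

lemma E_restr_finite:
  assumes a: "a \<in> l1space" and "finite K"
  shows "E (restr K a) = condexp (restr K a)"
  using assms(2)
proof (induction K rule: finite_induct)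
  case empty
  have "restr {} a = lscale 0 a" by (simp add: restr_def lscale_def)
  then show ?case using E_lscale[OF a, of 0] by (simp add: lscale_def condexp_def)
next
  case (insert k K)
  have "restr (insert k K) a = ladd (single k (a k)) (restr K a)"
    using insert.hyps by (intro ext) (auto simp: restr_def ladd_def single_def)
  then show ?case
    using insert.IH a
    by (simp add: E_ladd E_single condexp_ladd single_l1(1) restr_l1(1) l1_contfun)
qed

lemma E_eq_condexp:
  assumes a: "a \<in> l1space"
  shows "E a = condexp a"
proof (intro ext)
  fix n x
  have "cmod (E a n x - condexp a n x) \<le> e" if e: "e > 0" for e
  proof -
    obtain K where K: "finite K" "l1norm (restr (- K) a) \<le> e / 5"
      using restr_tail_small[OF a, of "e / 5"] e by auto
    let ?p = "restr K a" and ?r = "restr (- K) a"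
    note restr = restr_l1(1)[OF a]
    have "E a = ladd (condexp ?p) (E ?r)"
      using E_ladd[OF restr restr, of K "- K"] by (simp add: restr_split E_restr_finite[OF a K(1)])
    moreover have "condexp a = ladd (condexp ?p) (condexp ?r)"
      by (simp add: restr_split flip: condexp_ladd)
    ultimately have "cmod (E a n x - condexp a n x) = cmod (E ?r n x - condexp ?r n x)"
      by (simp add: ladd_def)
    also have "\<dots> \<le> 4 * l1norm ?r + l1norm ?r"
      using E_coefficient_bound[OF restr] cmod_le_l1norm[OF restr] l1norm_nonneg[OF restr]
      by (intro norm_triangle_le_diff add_mono) (simp_all add: condexp_def indicator_def)
    finally show ?thesis using K(2) by simp
  qed
  then have "cmod (E a n x - condexp a n x) \<le> 0" by (rule dense_ge)
  then show "E a n x = condexp a n x" by simp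
qed

end

sublocale positive_projection \<subseteq> clopen_dynamics
proof
  fix k
  have "contfun (E (single k (\<lambda>x. 1)) k)"
    using E_comm1[OF single_l1(1)[OF contfun_const]] by (simp add: comm1_l1 l1_contfun)
  moreover have "E (single k (\<lambda>x. 1)) k = indicator (FixI k)"
    unfolding E_single[OF contfun_const] by (simp add: condexp_def single_def)
  ultimately have "continuous_on UNIV (indicator (FixI k) :: 'a \<Rightarrow> complex)"
    by (simp add: contfun_def)
  then have "closed {x. indicator (FixI k) x = (1::complex)}"
    by (intro closed_Collect_eq continuous_intros)
  also have "{x. indicator (FixI k) x = (1::complex)} = FixI k" by (auto simp: indicator_def)
  finally show "closed (FixI k)" .
qed

context positive_projection
begin

lemma E_faithful: "faithful \<sigma> E"
  unfolding faithful_def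
proof (intro ballI impI)
  fix a assume a: "a \<in> poscone \<sigma>" "E a = lzero"
  then have "condexp a 0 x = lzero 0 x" for x
    using E_eq_condexp[OF poscone_l1] by simp
  then have "a 0 x = 0" for x by (simp add: condexp_def FixI_0 lzero_def)
  then show "a = lzero" by (rule poscone_eq_lzero[OF a(1)])
qed

lemma E_involutive: "involutive \<sigma> E"
  by (simp add: involutive_def E_eq_condexp lstar_l1 condexp_lstar)

lemma E_norm_one: "norm_one E"
  unfolding norm_one_def
proof (intro conjI ballI)
  show "l1norm (E a) \<le> l1norm a" if "a \<in> l1space" for a
    using that by (simp add: E_eq_condexp condexp_comm1(2))
  have "lone \<noteq> (lzero :: 'a elt)" by (auto simp: lone_def lzero_def emb_def fun_eq_iff)
  then show "\<exists>a\<in>l1space. a \<noteq> lzero \<and> l1norm (E a) = l1norm a"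
    by (intro bexI[of _ lone]) (auto simp: lone_l1 E_fixes_comm1 commutant.lone_mem)
qed

lemma E_bimodule_morphism: "bimodule_morphism \<sigma> E"
  by (simp add: bimodule_morphism_def E_eq_condexp lmult_l1 comm1_l1
      condexp_lmult_left condexp_lmult_right)

lemma E_image_c00space: "E ` c00space = comm00 \<sigma>"
proof
  show "E ` c00space \<subseteq> comm00 \<sigma>"
  proof clarify
    fix a :: "'a elt" assume "a \<in> c00space"
    then have a: "a \<in> l1space" "finite {k. a k \<noteq> (\<lambda>x. 0)}" by (auto simp: c00space_def)
    have "{k. E a k \<noteq> (\<lambda>x. 0)} \<subseteq> {k. a k \<noteq> (\<lambda>x. 0)}"
      by (auto simp: E_eq_condexp[OF a(1)] condexp_def)
    then have "finite {k. E a k \<noteq> (\<lambda>x. 0)}" by (rule finite_subset[OF _ a(2)])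
    then show "E a \<in> comm00 \<sigma>" using E_comm1[OF a(1)] by (simp add: comm00_eq c00space_def comm1_l1)
  qed
  show "comm00 \<sigma> \<subseteq> E ` c00space"
  proof
    fix b assume "b \<in> comm00 \<sigma>"
    then show "b \<in> E ` c00space"
      by (intro image_eqI[of _ _ b]) (simp_all add: comm00_eq E_fixes_comm1)
  qed
qed

end

theorem theorem5p7:
  fixes \<sigma> :: "'a::t2_space \<Rightarrow> 'a"
  assumes "compact (UNIV :: 'a set)"
    and "bij \<sigma>" and "continuous_on UNIV \<sigma>" and "continuous_on UNIV (inv \<sigma>)"
  shows "((\<forall>k::int. closed (interior (Fix \<sigma> k))) \<longleftrightarrow> (\<exists>E. is_pos_proj \<sigma> E))
    \<and> (\<forall>E1 E2. is_pos_proj \<sigma> E1 \<and> is_pos_proj \<sigma> E2 \<longrightarrow> (\<forall>a\<in>l1space. E1 a = E2 a))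
    \<and> (\<forall>E. is_pos_proj \<sigma> E \<longrightarrow>
         (\<forall>a\<in>l1space. E a = (\<lambda>k x. indicator (interior (Fix \<sigma> k)) x * a k x))
         \<and> faithful \<sigma> E \<and> involutive \<sigma> E \<and> norm_one E \<and> bimodule_morphism \<sigma> E
         \<and> E ` c00space = comm00 \<sigma>)"
proof -
  interpret compact_hausdorff_dynamics \<sigma> using assms by unfold_locales
  show ?thesis
  proof (intro conjI iffI allI impI)
    assume "\<forall>k. closed (FixI k)"
    then interpret clopen_dynamics \<sigma> by unfold_locales blast
    show "\<exists>E. is_pos_proj \<sigma> E" using is_pos_proj_condexp by blast
  next
    fix k assume "\<exists>E. is_pos_proj \<sigma> E"
    then obtain E where "is_pos_proj \<sigma> E" ..
    then interpret positive_projection \<sigma> E by unfold_locales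
    show "closed (FixI k)" by (rule closed_FixI)
  next
    fix E1 E2 assume "is_pos_proj \<sigma> E1 \<and> is_pos_proj \<sigma> E2"
    then interpret E1: positive_projection \<sigma> E1 + E2: positive_projection \<sigma> E2
      by unfold_locales auto
    show "\<forall>a\<in>l1space. E1 a = E2 a" by (simp add: E1.E_eq_condexp E2.E_eq_condexp)
  next
    fix E assume "is_pos_proj \<sigma> E"
    then interpret positive_projection \<sigma> E by unfold_locales
    show "\<forall>a\<in>l1space. E a = (\<lambda>k x. indicator (FixI k) x * a k x)"
      by (simp add: E_eq_condexp condexp_def)
    show "faithful \<sigma> E" "involutive \<sigma> E" "norm_one E" "bimodule_morphism \<sigma> E"
      "E ` c00space = comm00 \<sigma>"
      by (rule E_faithful E_involutive E_norm_one E_bimodule_morphism E_image_c00space)+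
  qed
qed

end
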